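(* For any finite area hyperbolic surface, no (embedded) distance circle can have positive measure of microlocal reflection symmetry.
   Context: A hyperbolic surface is $M=\mathbf{H}^2/\Gamma$, $\Gamma\subset PSL(2,\mathbb{R})$ a Fuchsian group. A distance circle (geodesic circle) is the set $H=C_r$ of points at distance $r$ from a given point, with $r$ small enough (less than the injectivity radius) that it is embedded. $G^t$ is the geodesic flow on $S^*M$; $S^*_HM$ is the set of unit covectors with footpoint on $H$; $r_H:S^*_HM\to S^*_HM$ fixes the component of a covector tangential to $H$ and reverses its normal component. $\mu_{L,H}$ is the pullback to $S^*_HM$ of the symplectic measure $|ds\wedge d\sigma|$ of $T^*H$ under the tangential projection $S^*_HM\to B^*H$ (unit coball bundle). For $(s,\xi)\in S^*_HM$, $T^{(j)}(s,\xi)$, $j\ne0$, is the time of the $j$-th return of $G^t(s,\xi)$ to $S^*_HM$ (backward in time for $j<0$), when finite. $H$ has positive measure of microlocal reflection symmetry if $$\mu_{L,H}\Big(\bigcup_{j\ne0}\{(s,\xi)\in S^*_HM:r_HG^{T^{(j)}(s,\xi)}(s,\xi)=G^{T^{(j)}(s,\xi)}r_H(s,\xi)\}\Big)>0 .$$ *)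

theory Defs
  imports "HOL-Analysis.Analysis" "HOL-Algebra.Coset"
begin

section \<open>The hyperbolic plane and \<open>PSL(2,R)\<close>\<close>

text \<open>The hyperbolic plane is the upper half plane with the metric $|dz|^2 / (\mathrm{Im}\, z)^2$.\<close>

definition hplane :: "complex set" where
  "hplane = {z. 0 < Im z}"

definition hdist :: "complex \<Rightarrow> complex \<Rightarrow> real" where
  "hdist z w = arcosh (1 + (cmod (z - w))\<^sup>2 / (2 * Im z * Im w))"

definition hnorm :: "complex \<Rightarrow> complex \<Rightarrow> real" where
  "hnorm z v = cmod v / Im z"

definition harea :: "complex measure" where
  "harea = density lborel (\<lambda>z. indicator hplane z * ennreal (1 / (Im z)\<^sup>2))"

definition SL2R :: "(real^2^2) monoid" where
  "SL2R = \<lparr>carrier = {A. det A = 1}, mult = (**), one = mat 1\<rparr>"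

text \<open>Elements of \<open>PSL(2,R)\<close> are the cosets \<open>{A, -A}\<close>.\<close>

definition PSL2R :: "(real^2^2) set monoid" where
  "PSL2R = SL2R Mod {mat 1, - mat 1}"

text \<open>A set of elements of \<open>PSL(2,R)\<close> is discrete iff its preimage in \<open>SL(2,R)\<close>, which is its union,
  is a discrete set of matrices, because \<open>SL(2,R) \<rightarrow> PSL(2,R)\<close> is a two-sheeted covering.\<close>

definition fuchsian :: "(real^2^2) set set \<Rightarrow> bool" where
  "fuchsian \<Gamma> \<longleftrightarrow> subgroup \<Gamma> PSL2R \<and> discrete (\<Union>\<Gamma>)"

definition moebius_denom :: "real^2^2 \<Rightarrow> complex \<Rightarrow> complex" where
  "moebius_denom A z = of_real (A $ 2 $ 1) * z + of_real (A $ 2 $ 2)"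

definition moebius :: "real^2^2 \<Rightarrow> complex \<Rightarrow> complex" where
  "moebius A z = (of_real (A $ 1 $ 1) * z + of_real (A $ 1 $ 2)) / moebius_denom A z"

section \<open>Covectors\<close>

text \<open>A covector at \<open>z\<close> is written as \<open>(z, \<zeta>)\<close> and stands for the linear form
  \<open>v \<mapsto> inner \<zeta> v\<close> on the tangent space \<open>\<complex>\<close> at \<open>z\<close> (\<open>inner\<close> is the Euclidean inner product).
  Its norm dual to \<open>hnorm z\<close> is \<open>Im z * cmod \<zeta>\<close>.\<close>

type_synonym covector = "complex \<times> complex"

definition unit_covectors :: "covector set" where
  "unit_covectors = {(z, \<zeta>). z \<in> hplane \<and> Im z * cmod \<zeta> = 1}"

text \<open>The isomorphisms between covectors and vectors induced by the hyperbolic metric.\<close>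

definition sharp :: "complex \<Rightarrow> complex \<Rightarrow> complex" where
  "sharp z \<zeta> = of_real ((Im z)\<^sup>2) * \<zeta>"

definition flat :: "complex \<Rightarrow> complex \<Rightarrow> complex" where
  "flat z v = v / of_real ((Im z)\<^sup>2)"

text \<open>The transformation \<open>A\<close> has derivative \<open>1 / (moebius_denom A z)\<^sup>2\<close> at \<open>z\<close>; the covector \<open>\<zeta>\<close> is
  transported by composition with the inverse of this derivative, whose adjoint is multiplication
  with the complex conjugate.\<close>

definition moebius_cov :: "real^2^2 \<Rightarrow> covector \<Rightarrow> covector" where
  "moebius_cov A = (\<lambda>(z, \<zeta>). (moebius A z, cnj ((moebius_denom A z)\<^sup>2) * \<zeta>))"

section \<open>The surface \<open>H\<^sup>2/\<Gamma>\<close>\<close>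

text \<open>Points of the surface and of its unit cosphere bundle are \<open>\<Gamma>\<close>-orbits.\<close>

definition proj :: "(real^2^2) set set \<Rightarrow> complex \<Rightarrow> complex set" where
  "proj \<Gamma> z = (\<lambda>A. moebius A z) ` \<Union>\<Gamma>"

definition surface :: "(real^2^2) set set \<Rightarrow> complex set set" where
  "surface \<Gamma> = proj \<Gamma> ` hplane"

definition cov_proj :: "(real^2^2) set set \<Rightarrow> covector \<Rightarrow> covector set" where
  "cov_proj \<Gamma> x = (\<lambda>A. moebius_cov A x) ` \<Union>\<Gamma>"

definition cosphere :: "(real^2^2) set set \<Rightarrow> covector set set" where
  "cosphere \<Gamma> = cov_proj \<Gamma> ` unit_covectors"

definition footpoint :: "covector set \<Rightarrow> complex set" where
  "footpoint X = fst ` X"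

definition finite_area :: "(real^2^2) set set \<Rightarrow> bool" where
  "finite_area \<Gamma> \<longleftrightarrow>
     (\<exists>F. F \<in> sets borel \<and> F \<subseteq> hplane \<and> (\<forall>z\<in>hplane. \<exists>!x. x \<in> F \<and> x \<in> proj \<Gamma> z) \<and>
          emeasure harea F < \<infinity>)"

definition surf_dist :: "complex set \<Rightarrow> complex set \<Rightarrow> real" where
  "surf_dist p q = Inf {hdist z w | z w. z \<in> p \<and> w \<in> q}"

text \<open>Injectivity radius at the point \<open>proj \<Gamma> w\<close>: the exponential map at this point is \<open>proj \<Gamma>\<close>
  composed with the exponential map of the hyperbolic plane at \<open>w\<close>, and the latter is a bijection
  from the ball of radius \<open>R\<close> onto \<open>{z \<in> hplane. hdist w z < R}\<close>.\<close>

definition inj_radius :: "(real^2^2) set set \<Rightarrow> complex \<Rightarrow> ereal" where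
  "inj_radius \<Gamma> w = Sup {ereal R | R. inj_on (proj \<Gamma>) {z \<in> hplane. hdist w z < R}}"

definition distance_circle :: "(real^2^2) set set \<Rightarrow> complex \<Rightarrow> real \<Rightarrow> complex set set" where
  "distance_circle \<Gamma> w r = {q \<in> surface \<Gamma>. surf_dist (proj \<Gamma> w) q = r}"

section \<open>Geodesic flow\<close>

text \<open>Unit speed geodesics of the hyperbolic plane are its isometrically embedded real lines.\<close>

definition hgeodesic :: "(real \<Rightarrow> complex) \<Rightarrow> bool" where
  "hgeodesic c \<longleftrightarrow> (\<forall>t. c t \<in> hplane) \<and> (\<forall>s t. hdist (c s) (c t) = \<bar>s - t\<bar>)"

definition geodesic_from :: "covector \<Rightarrow> real \<Rightarrow> complex" where
  "geodesic_from = (\<lambda>(z, \<zeta>).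
     (THE c. hgeodesic c \<and> c 0 = z \<and> (c has_vector_derivative sharp z \<zeta>) (at 0)))"

definition hflow :: "real \<Rightarrow> covector \<Rightarrow> covector" where
  "hflow t x = (let c = geodesic_from x in (c t, flat (c t) (vector_derivative c (at t))))"

text \<open>The flow commutes with \<open>\<Gamma>\<close>, so the image of an orbit is an orbit.\<close>

definition gflow :: "real \<Rightarrow> covector set \<Rightarrow> covector set" where
  "gflow t X = hflow t ` X"

section \<open>Covectors with footpoint on a curve, and reflection\<close>

text \<open>In this section \<open>H\<close> is a curve in the surface.\<close>

definition cosphere_over :: "(real^2^2) set set \<Rightarrow> complex set set \<Rightarrow> covector set set" where
  "cosphere_over \<Gamma> H = {X \<in> cosphere \<Gamma>. footpoint X \<in> H}"

definition tangent_space :: "(real^2^2) set set \<Rightarrow> complex set set \<Rightarrow> complex \<Rightarrow> complex set" where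
  "tangent_space \<Gamma> H z =
     {v. \<exists>c :: real \<Rightarrow> complex. (\<forall>t. c t \<in> hplane \<and> proj \<Gamma> (c t) \<in> H) \<and> c 0 = z \<and>
           (c has_vector_derivative v) (at 0)}"

text \<open>Reflection keeps the values of a covector on tangent vectors of (the lift of) \<open>H\<close> and reverses
  those on normal vectors; Euclidean and hyperbolic orthogonality coincide.\<close>

definition hreflect :: "(real^2^2) set set \<Rightarrow> complex set set \<Rightarrow> covector \<Rightarrow> covector" where
  "hreflect \<Gamma> H = (\<lambda>(z, \<zeta>). (z, THE \<zeta>'.
     (\<forall>v\<in>tangent_space \<Gamma> H z. inner \<zeta>' v = inner \<zeta> v) \<and>
     (\<forall>n. (\<forall>v\<in>tangent_space \<Gamma> H z. inner n v = 0) \<longrightarrow> inner \<zeta>' n = - inner \<zeta> n)))"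

definition reflect :: "(real^2^2) set set \<Rightarrow> complex set set \<Rightarrow> covector set \<Rightarrow> covector set" where
  "reflect \<Gamma> H X = hreflect \<Gamma> H ` X"

section \<open>Return times\<close>

text \<open>The value is infinite if there is no such return.\<close>

fun forward_return ::
  "(real^2^2) set set \<Rightarrow> complex set set \<Rightarrow> nat \<Rightarrow> covector set \<Rightarrow> ereal" where
  "forward_return \<Gamma> H 0 X = 0"
| "forward_return \<Gamma> H (Suc n) X =
     Inf {ereal t | t. forward_return \<Gamma> H n X < ereal t \<and> gflow t X \<in> cosphere_over \<Gamma> H}"

fun backward_return ::
  "(real^2^2) set set \<Rightarrow> complex set set \<Rightarrow> nat \<Rightarrow> covector set \<Rightarrow> ereal" where
  "backward_return \<Gamma> H 0 X = 0"
| "backward_return \<Gamma> H (Suc n) X =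
     Sup {ereal t | t. ereal t < backward_return \<Gamma> H n X \<and> gflow t X \<in> cosphere_over \<Gamma> H}"

definition return_time ::
  "(real^2^2) set set \<Rightarrow> complex set set \<Rightarrow> int \<Rightarrow> covector set \<Rightarrow> ereal" where
  "return_time \<Gamma> H j X =
     (if 0 \<le> j then forward_return \<Gamma> H (nat j) X else backward_return \<Gamma> H (nat (- j)) X)"

definition reflection_symmetric ::
  "(real^2^2) set set \<Rightarrow> complex set set \<Rightarrow> int \<Rightarrow> covector set set" where
  "reflection_symmetric \<Gamma> H j =
     {X \<in> cosphere_over \<Gamma> H. \<bar>return_time \<Gamma> H j X\<bar> \<noteq> \<infinity> \<and>
        (let T = real_of_ereal (return_time \<Gamma> H j X)
         in reflect \<Gamma> H (gflow T X) = gflow T (reflect \<Gamma> H X))}"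

section \<open>The measure \<open>\<mu>\<^bsub>L,H\<^esub>\<close> for a distance circle\<close>

text \<open>Geodesic polar coordinates at \<open>w\<close>: the covector \<open>cis \<theta> / Im w\<close> is the unit covector at \<open>w\<close> in
  direction \<open>\<theta>\<close>. For \<open>r\<close> below the injectivity radius, \<open>\<theta> \<in> {0..<2*pi}\<close> parametrizes the distance
  circle bijectively.\<close>

definition polar_circle :: "complex \<Rightarrow> real \<Rightarrow> real \<Rightarrow> complex" where
  "polar_circle w r \<theta> = fst (hflow r (w, cis \<theta> / of_real (Im w)))"

definition circle_speed :: "complex \<Rightarrow> real \<Rightarrow> real \<Rightarrow> real" where
  "circle_speed w r \<theta> =
     hnorm (polar_circle w r \<theta>) (vector_derivative (polar_circle w r) (at \<theta>))"

definition circle_tangent :: "complex \<Rightarrow> real \<Rightarrow> real \<Rightarrow> complex" where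
  "circle_tangent w r \<theta> =
     vector_derivative (polar_circle w r) (at \<theta>) / of_real (circle_speed w r \<theta>)"

text \<open>Covectors of the circle \<open>H\<close> have canonical coordinates \<open>(s, \<sigma>)\<close>, with \<open>s\<close> the arclength and
  \<open>\<sigma>\<close> the value on the unit tangent vector. With \<open>\<theta>\<close> in place of \<open>s\<close>, the symplectic measure
  \<open>\<bar>ds \<and> d\<sigma>\<bar>\<close> becomes \<open>circle_speed w r \<theta> d\<theta> d\<sigma>\<close>.\<close>

definition symplectic_measure :: "complex \<Rightarrow> real \<Rightarrow> (real \<times> real) measure" where
  "symplectic_measure w r = density lborel (\<lambda>(\<theta>, \<sigma>). ennreal (circle_speed w r \<theta>))"

text \<open>The coordinates of the images, under the tangential projection (restriction of a covector to
  tangent vectors of \<open>H\<close>), of those elements of \<open>B\<close> whose normal component has sign \<open>\<epsilon>\<close> or vanishes.\<close>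

definition tangential_projection ::
  "(real^2^2) set set \<Rightarrow> complex \<Rightarrow> real \<Rightarrow> real \<Rightarrow> covector set set \<Rightarrow> (real \<times> real) set" where
  "tangential_projection \<Gamma> w r \<epsilon> B =
     {(\<theta>, inner \<zeta> (circle_tangent w r \<theta>)) | \<theta> \<zeta>.
        \<theta> \<in> {0..<2 * pi} \<and> (polar_circle w r \<theta>, \<zeta>) \<in> unit_covectors \<and>
        cov_proj \<Gamma> (polar_circle w r \<theta>, \<zeta>) \<in> B \<and>
        0 \<le> \<epsilon> * inner \<zeta> (\<i> * circle_tangent w r \<theta>)}"

text \<open>The tangential projection is two-to-one onto the open coball bundle and injective on each of
  the halves of \<open>S\<^sup>*\<^sub>H M\<close> given by the sign of the normal component, so the pullback measure is the sum
  of the measures of the images of the two halves. (The common boundary, the covectors tangential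
  to \<open>H\<close>, is a null set.) The outer measure agrees with the measure for measurable sets, and it
  prevents sets that are not measurable from having measure zero by convention.\<close>

definition mu_LH :: "(real^2^2) set set \<Rightarrow> complex \<Rightarrow> real \<Rightarrow> covector set set \<Rightarrow> ennreal" where
  "mu_LH \<Gamma> w r B =
     (\<Sum>\<epsilon>\<in>{1, -1}. outer_measure_of (symplectic_measure w r) (tangential_projection \<Gamma> w r \<epsilon> B))"

definition positive_reflection_symmetry :: "(real^2^2) set set \<Rightarrow> complex \<Rightarrow> real \<Rightarrow> bool" where
  "positive_reflection_symmetry \<Gamma> w r \<longleftrightarrow>
     mu_LH \<Gamma> w r (\<Union>j\<in>{j. j \<noteq> 0}. reflection_symmetric \<Gamma> (distance_circle \<Gamma> w r) j) > 0"

end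

theory Submission
  imports Defs
begin

text \<open>In the hyperboloid model, an isometry acts linearly, the flow sends position and velocity
  $(P, V)$ to $(\cosh t\, P + \sinh t\, V, \sinh t\, P + \cosh t\, V)$, and the reflection at a circle
  with centre $U$ reverses $\langle V, U \rangle$. Suppose that the flow for time $T \neq 0$ commutes with
  the reflection at $(P, V)$. Let $V'$ be the reflection of $V$, let $U_1$ be the lift of the centre
  whose circle is met at time $T$, and let $U_2$ be the lift to which the element of $\Gamma$ occurring in
  the symmetry condition pulls $U_1$ back. The condition then becomes
  $\langle P, U_1 + U_2 \rangle = 2 \cosh r \cosh T$ and
  $\langle V, U_1 \rangle + \langle V', U_2 \rangle = -2 \cosh r \sinh T$. Eliminating $T$ shows that a
  linear form in $V$ which depends only on $P$, $U_1$, $U_2$ has a prescribed nonzero square, which leaves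
  only finitely many $V$ over each $P$. As there are countably many pairs $(U_1, U_2)$, the
  symmetric covectors form a null set by Fubini's theorem.\<close>

section \<open>The hyperboloid model\<close>

text \<open>A return time is an infimum or supremum, so a priori it need be neither attained nor
  nonzero. The value \<open>T = 0\<close> would be fatal: there the symmetry condition holds for
  every covector over the circle, and correspondingly, for both lifts equal to the centre
  \<open>w\<close>, the linear form in the velocity vanishes identically and so does its prescribed
  square. A radius \<open>R > r\<close> up to which the projection is still injective removes both
  doubts: meetings within time \<open>R - r\<close> of a given moment are all with one lift of the
  circle, so the meeting times form a closed set in which \<open>0\<close> is isolated. Then
  \<open>T \<noteq> 0\<close> makes the prescribed square positive, and a vanishing form cannot
  satisfy the condition.

  Symmetry on the surface is an equality of \<open>\<Gamma>\<close>-orbits, so for representatives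
  it holds only up to an element of \<open>\<Gamma>\<close>.\<close>

type_synonym vec3 = "real \<times> real \<times> real"

text \<open>If \<open>(a, b, c)\<close> is read as the symmetric matrix with rows
  \<open>(c, b)\<close> and \<open>(b, a)\<close>, this is the polarization of the determinant, a
  form of signature (1, 2).\<close>

definition mink :: "vec3 \<Rightarrow> vec3 \<Rightarrow> real" where
  "mink X Y = (fst X * snd (snd Y) + snd (snd X) * fst Y - 2 * fst (snd X) * fst (snd Y)) / 2"

definition hvec :: "complex \<Rightarrow> vec3" where
  "hvec z = (1 / Im z, Re z / Im z, (cmod z)\<^sup>2 / Im z)"

text \<open>The derivative of \<open>hvec\<close> at \<open>z\<close> in the direction
  \<open>sharp z \<zeta>\<close>.\<close>

definition tvec :: "complex \<Rightarrow> complex \<Rightarrow> vec3" where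
  "tvec z \<zeta> = (Im (cnj \<zeta>), Im (cnj \<zeta> * z), Im (cnj \<zeta> * z\<^sup>2))"

definition pt :: "vec3 \<Rightarrow> complex" where
  "pt X = Complex (fst (snd X) / fst X) (1 / fst X)"

abbreviation pos :: "covector \<Rightarrow> vec3" where
  "pos x \<equiv> hvec (fst x)"

abbreviation vel :: "covector \<Rightarrow> vec3" where
  "vel x \<equiv> tvec (fst x) (snd x)"

lemma mink_add_left: "mink (X + Y) Z = mink X Z + mink Y Z"
  and mink_add_right: "mink Z (X + Y) = mink Z X + mink Z Y"
  and mink_diff_left: "mink (X - Y) Z = mink X Z - mink Y Z"
  and mink_diff_right: "mink Z (X - Y) = mink Z X - mink Z Y"
  and mink_scaleR_left: "mink (a *\<^sub>R X) Z = a * mink X Z"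
  and mink_scaleR_right: "mink Z (a *\<^sub>R X) = a * mink Z X"
  by (simp_all add: mink_def field_simps)

lemmas mink_linear = mink_add_left mink_add_right mink_diff_left mink_diff_right
  mink_scaleR_left mink_scaleR_right

lemma mink_commute: "mink X Y = mink Y X"
  by (simp add: mink_def)

lemma mink_hvec:
  assumes "z \<in> hplane" "w \<in> hplane"
  shows "mink (hvec z) (hvec w) = 1 + (cmod (z - w))\<^sup>2 / (2 * Im z * Im w)"
proof -
  have "0 < Im z" "0 < Im w" using assms by (auto simp: hplane_def)
  then show ?thesis
    by (simp add: mink_def hvec_def cmod_power2 divide_simps) (simp add: power2_eq_square algebra_simps)
qed

lemma mink_hvec_ge_1: "1 \<le> mink (hvec z) (hvec w)" if "z \<in> hplane" "w \<in> hplane"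
  using that by (simp add: mink_hvec hplane_def)

lemma mink_hvec_self [simp]: "mink (hvec z) (hvec z) = 1" if "z \<in> hplane"
  using that by (simp add: mink_hvec)

lemma hdist_conv_mink: "hdist z w = arcosh (mink (hvec z) (hvec w))"
  if "z \<in> hplane" "w \<in> hplane"
  using that by (simp add: hdist_def mink_hvec)

lemma hdist_nonneg: "0 \<le> hdist z w" if "z \<in> hplane" "w \<in> hplane"
  using that by (simp add: hdist_conv_mink mink_hvec_ge_1)

lemma cosh_hdist: "cosh (hdist z w) = mink (hvec z) (hvec w)" if "z \<in> hplane" "w \<in> hplane"
  using that by (simp add: hdist_conv_mink mink_hvec_ge_1 cosh_arcosh_real)

lemma hdist_eq_iff: "hdist z w = r \<longleftrightarrow> mink (hvec z) (hvec w) = cosh r"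
  if "z \<in> hplane" "w \<in> hplane" "0 \<le> r"
  by (metis arcosh_cosh_real cosh_hdist hdist_nonneg that)

lemma hdist_less_iff: "hdist z w < r \<longleftrightarrow> mink (hvec z) (hvec w) < cosh r"
  if "z \<in> hplane" "w \<in> hplane" "0 \<le> r"
  by (metis cosh_real_nonneg_less_iff cosh_hdist hdist_nonneg that)

lemma pt_hvec [simp]: "pt (hvec z) = z" if "z \<in> hplane"
  using that by (simp add: pt_def hvec_def hplane_def complex_eq_iff)

lemma hvec_inj: "hvec z = hvec w \<Longrightarrow> z \<in> hplane \<Longrightarrow> w \<in> hplane \<Longrightarrow> z = w"
  by (metis pt_hvec)

lemma pt_in_hplane: "0 < fst X \<Longrightarrow> pt X \<in> hplane"
  by (simp add: pt_def hplane_def)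

lemma hvec_pt: "hvec (pt X) = X" if "0 < fst X" "mink X X = 1"
proof -
  obtain a b c where X: "X = (a, b, c)" by (cases X)
  have a: "a > 0" and e: "a * c - b * b = 1" using that by (auto simp: X mink_def field_simps)
  have "(b\<^sup>2 / a\<^sup>2 + 1 / a\<^sup>2) * a = c"
    using a e by (simp add: field_simps power2_eq_square)
  then show ?thesis using a by (simp add: X hvec_def pt_def cmod_power2 power_divide)
qed

section \<open>Tangent vectors of the hyperboloid\<close>

lemma tvec_linear: "tvec z (\<zeta> + \<eta>) = tvec z \<zeta> + tvec z \<eta>"
  "tvec z (\<zeta> - \<eta>) = tvec z \<zeta> - tvec z \<eta>"
  "tvec z (of_real a * \<zeta>) = a *\<^sub>R tvec z \<zeta>"
  by (simp_all add: tvec_def algebra_simps)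

lemma mink_hvec_tvec [simp]: "mink (hvec z) (tvec z \<zeta>) = 0" "mink (tvec z \<zeta>) (hvec z) = 0"
  by (simp_all add: mink_def hvec_def tvec_def cmod_power2 divide_simps)
     (simp_all add: power2_eq_square algebra_simps)

lemma mink_tvec: "mink (tvec z \<zeta>) (tvec z \<eta>) = - (Im z)\<^sup>2 * inner \<zeta> \<eta>"
  by (simp add: mink_def tvec_def inner_complex_def power2_eq_square) (simp add: field_simps)

text \<open>The tangent plane is the whole orthogonal complement of the position.\<close>

lemma tvec_surj:
  assumes "z \<in> hplane" "mink (hvec z) X = 0"
  obtains \<zeta> where "X = tvec z \<zeta>"
proof -
  obtain a b c where X: "X = (a, b, c)" by (cases X)
  obtain x y where z: "z = Complex x y" by (cases z)
  have y: "y > 0" using assms(1) by (simp add: z hplane_def)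
  have c: "c = 2 * x * b - (x\<^sup>2 + y\<^sup>2) * a"
    using assms(2) y by (simp add: X z mink_def hvec_def cmod_power2 divide_simps)
  \<comment> \<open>Read off from the first two coordinates of \<open>tvec\<close>, which are
    \<open>- Im \<zeta>\<close> and \<open>y * Re \<zeta> - x * Im \<zeta>\<close>.\<close>
  have "X = tvec z (Complex ((b - x * a) / y) (- a))"
    using y by (simp add: X z c tvec_def field_simps power2_eq_square)
  then show ?thesis by (rule that)
qed

text \<open>The form is negative definite on the tangent plane.\<close>

lemma null_orthogonal_eq_0:
  assumes z: "z \<in> hplane" and X: "mink (hvec z) X = 0" "mink X X = 0"
  shows "X = 0"
proof -
  obtain \<zeta> where \<zeta>: "X = tvec z \<zeta>" using tvec_surj[OF z X(1)] .
  then have "\<zeta> = 0" using X(2) z by (simp add: mink_tvec hplane_def)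
  then show ?thesis by (simp add: \<zeta> tvec_def zero_prod_def)
qed

lemma tvec_inj: "tvec z \<zeta> = tvec z \<eta> \<Longrightarrow> z \<in> hplane \<Longrightarrow> \<zeta> = \<eta>"
  by (auto simp: tvec_def hplane_def complex_eq_iff)

text \<open>Orthogonality to the position determines the third coordinate from the other
  two.\<close>

lemma tvec_eqI:
  assumes z: "z \<in> hplane" and "mink (hvec z) X = 0" "mink (hvec z) Y = 0"
    and "fst X = fst Y" "fst (snd X) = fst (snd Y)"
  shows "X = Y"
proof -
  have "mink (hvec z) (X - Y) = 0" using assms by (simp add: mink_linear)
  then have "snd (snd X) = snd (snd Y)" using assms by (simp add: mink_def hvec_def hplane_def)
  then show ?thesis using assms by (simp add: prod_eq_iff hplane_def)
qed

lemma pt_has_vector_derivative: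
  assumes X: "(X has_vector_derivative Y) (at t)" and "X t = hvec z" "z \<in> hplane" "Y = tvec z \<zeta>"
  shows "((\<lambda>t. pt (X t)) has_vector_derivative sharp z \<zeta>) (at t)"
proof -
  have y: "Im z > 0" using assms by (simp add: hplane_def)
  have 1: "((\<lambda>t. fst (X t)) has_real_derivative fst Y) (at t)"
    using bounded_linear.has_vector_derivative[OF bounded_linear_fst X]
    by (simp add: has_real_derivative_iff_has_vector_derivative)
  have 2: "((\<lambda>t. fst (snd (X t))) has_real_derivative fst (snd Y)) (at t)"
    using bounded_linear.has_vector_derivative[OF bounded_linear_fst
        bounded_linear.has_vector_derivative[OF bounded_linear_snd X]]
    by (simp add: has_real_derivative_iff_has_vector_derivative)
  have n: "fst (X t) \<noteq> 0" using assms y by (simp add: hvec_def)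
  have d1: "((\<lambda>t. fst (snd (X t)) / fst (X t)) has_real_derivative Re (sharp z \<zeta>)) (at t)"
    by (rule derivative_eq_intros 1 2 n refl)+
       (use assms y in \<open>simp add: hvec_def tvec_def sharp_def field_simps power2_eq_square\<close>)
  have d2: "((\<lambda>t. 1 / fst (X t)) has_real_derivative Im (sharp z \<zeta>)) (at t)"
    by (rule derivative_eq_intros 1 2 n refl)+
       (use assms y in \<open>simp add: hvec_def tvec_def sharp_def field_simps power2_eq_square\<close>)
  show ?thesis
    unfolding pt_def has_vector_derivative_complex_iff using d1 d2 by simp
qed

section \<open>The geodesic flow\<close>

lemma unit_covectors_iff: "x \<in> unit_covectors \<longleftrightarrow> fst x \<in> hplane \<and> mink (vel x) (vel x) = -1"
proof (cases x)
  case (Pair z \<zeta>)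
  have "Im z * cmod \<zeta> = 1 \<longleftrightarrow> (Im z * cmod \<zeta>)\<^sup>2 = 1" if "Im z > 0"
    using that by (auto simp: power2_eq_1_iff) (smt (verit) mult_nonneg_nonneg norm_ge_zero)
  then show ?thesis
    by (auto simp: Pair unit_covectors_def mink_tvec hplane_def power_mult_distrib power2_norm_eq_inner)
qed

text \<open>Keeps the first coordinate positive along the orbit in \<open>geo\<close>, which
  therefore stays on the upper sheet.\<close>

lemma abs_fst_tvec_le: "\<bar>fst (vel x)\<bar> \<le> fst (pos x)" if "x \<in> unit_covectors"
proof -
  obtain z \<zeta> where x: "x = (z, \<zeta>)" by (cases x)
  have "Im z > 0" "Im z * cmod \<zeta> = 1" using that by (auto simp: x unit_covectors_def hplane_def)
  then have "cmod \<zeta> = 1 / Im z" by (simp add: field_simps)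
  then show ?thesis using abs_Im_le_cmod[of \<zeta>] by (simp add: x hvec_def tvec_def)
qed

lemma cosh_gt_abs_sinh: "\<bar>sinh t\<bar> < cosh (t::real)"
  by (smt (verit) cosh_plus_sinh cosh_minus_sinh exp_gt_zero)

definition geo :: "covector \<Rightarrow> real \<Rightarrow> complex" where
  "geo x t = pt (cosh t *\<^sub>R pos x + sinh t *\<^sub>R vel x)"

lemma geo:
  assumes x: "x \<in> unit_covectors"
  shows hvec_geo: "hvec (geo x t) = cosh t *\<^sub>R pos x + sinh t *\<^sub>R vel x"
    and geo_in_hplane: "geo x t \<in> hplane"
proof -
  have p: "fst (pos x) > 0" using x by (simp add: unit_covectors_iff hplane_def hvec_def)
  have "\<bar>sinh t * fst (vel x)\<bar> \<le> \<bar>sinh t\<bar> * fst (pos x)"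
    using abs_fst_tvec_le[OF x] by (simp add: abs_mult mult_left_mono)
  also have "\<dots> < cosh t * fst (pos x)" using p cosh_gt_abs_sinh by simp
  finally have a: "0 < fst (cosh t *\<^sub>R pos x + sinh t *\<^sub>R vel x)" by simp
  have "mink (cosh t *\<^sub>R pos x + sinh t *\<^sub>R vel x) (cosh t *\<^sub>R pos x + sinh t *\<^sub>R vel x) = 1"
    using x cosh_square_eq[of t] by (simp add: unit_covectors_iff mink_linear power2_eq_square)
  with a show "hvec (geo x t) = cosh t *\<^sub>R pos x + sinh t *\<^sub>R vel x" "geo x t \<in> hplane"
    unfolding geo_def by (simp_all add: hvec_pt pt_in_hplane)
qed

lemma orbit_has_vector_derivative:
  "((\<lambda>t. cosh t *\<^sub>R P + sinh t *\<^sub>R V) has_vector_derivative (sinh t *\<^sub>R P + cosh t *\<^sub>R V)) (at t)"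
  for P V :: vec3
  by (auto intro!: derivative_eq_intros)

lemma geo_velocity:
  assumes x: "x \<in> unit_covectors"
  obtains \<eta> where "tvec (geo x t) \<eta> = sinh t *\<^sub>R pos x + cosh t *\<^sub>R vel x"
    "(geo x has_vector_derivative sharp (geo x t) \<eta>) (at t)"
proof -
  have "mink (hvec (geo x t)) (sinh t *\<^sub>R pos x + cosh t *\<^sub>R vel x) = 0"
    using x by (simp add: hvec_geo unit_covectors_iff mink_linear)
  then obtain \<eta> where \<eta>: "sinh t *\<^sub>R pos x + cosh t *\<^sub>R vel x = tvec (geo x t) \<eta>"
    using tvec_surj[OF geo_in_hplane[OF x]] by blast
  have "((\<lambda>t. pt (cosh t *\<^sub>R pos x + sinh t *\<^sub>R vel x)) has_vector_derivative sharp (geo x t) \<eta>) (at t)"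
    by (rule pt_has_vector_derivative[OF orbit_has_vector_derivative])
       (use \<eta> hvec_geo[OF x] geo_in_hplane[OF x] in auto)
  with \<eta> show ?thesis by (intro that[of \<eta>]) (simp_all add: geo_def [abs_def])
qed

lemma geo_0: "geo x 0 = fst x" if "x \<in> unit_covectors"
  using that by (simp add: geo_def unit_covectors_iff)

lemma hgeodesic_geo: "hgeodesic (geo x)" if x: "x \<in> unit_covectors"
  unfolding hgeodesic_def
proof (intro conjI allI)
  show "geo x t \<in> hplane" for t using x by (rule geo_in_hplane)
  show "hdist (geo x s) (geo x t) = \<bar>s - t\<bar>" for s t
    using x by (subst hdist_eq_iff)
      (auto simp: geo_in_hplane hvec_geo mink_linear unit_covectors_iff cosh_diff)
qed

text \<open>Three points of a geodesic have a degenerate Gram matrix, so they are linearly dependent.\<close>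

lemma hgeodesic_linear:
  assumes c: "hgeodesic c"
  shows "hvec (c t) = cosh t *\<^sub>R hvec (c 0) + sinh t *\<^sub>R ((1 / sinh 1) *\<^sub>R (hvec (c 1) - cosh 1 *\<^sub>R hvec (c 0)))"
    (is "_ = ?Q")
proof -
  have h: "c s \<in> hplane" for s using c by (simp add: hgeodesic_def)
  have m: "mink (hvec (c s)) (hvec (c t)) = cosh (s - t)" for s t
    using c hdist_eq_iff[OF h h, of "\<bar>s - t\<bar>" s t] by (simp add: hgeodesic_def)
  define k where "k = sinh t / sinh 1"
  have k: "?Q = (cosh t - k * cosh 1) *\<^sub>R hvec (c 0) + k *\<^sub>R hvec (c 1)"
    by (simp add: k_def algebra_simps)
  have ks: "sinh t = k * sinh 1" by (simp add: k_def)
  define C where "C = cosh (1::real)"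
  define D where "D = sinh (1::real)"
  have e1: "(cosh t)\<^sup>2 - k\<^sup>2 * D\<^sup>2 = 1" using cosh_square_eq[of t] by (simp add: ks D_def power_mult_distrib)
  have e2: "C\<^sup>2 - D\<^sup>2 = 1" using cosh_square_eq[of "1::real"] by (simp add: C_def D_def)
  have kd: "cosh (t - 1) = cosh t * C - k * D\<^sup>2" "cosh (1 - t) = cosh t * C - k * D\<^sup>2"
    by (simp_all add: cosh_diff ks C_def D_def power2_eq_square)
  have "hvec (c t) - ?Q = 0"
  proof (rule null_orthogonal_eq_0[OF h[of 0]])
    show "mink (hvec (c 0)) (hvec (c t) - ?Q) = 0"
      unfolding k by (simp add: mink_linear m)
    show "mink (hvec (c t) - ?Q) (hvec (c t) - ?Q) = 0"
      unfolding k using e1 e2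
      by (simp add: mink_linear m kd flip: C_def) algebra
  qed
  then show ?thesis by simp
qed

text \<open>A distance preserving curve is already linear in \<open>cosh t\<close> and
  \<open>sinh t\<close>; only the vector \<open>V\<close> is free, and the derivative at 0
  determines it. This justifies the definite description in \<open>geodesic_from\<close>.\<close>

lemma hgeodesic_unique:
  assumes x: "x \<in> unit_covectors" and c: "hgeodesic c" "c 0 = fst x"
    "(c has_vector_derivative sharp (fst x) (snd x)) (at 0)"
  shows "c = geo x"
proof -
  define V where "V = (1 / sinh 1) *\<^sub>R (hvec (c 1) - cosh 1 *\<^sub>R hvec (c 0))"
  have h: "c s \<in> hplane" for s using c by (simp add: hgeodesic_def)
  have lin: "hvec (c t) = cosh t *\<^sub>R pos x + sinh t *\<^sub>R V" for t
    using hgeodesic_linear[OF c(1), of t] c(2) by (simp add: V_def)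
  have "hdist (c 0) (c 1) = 1" using c(1) by (simp add: hgeodesic_def)
  then have "mink (hvec (c 0)) (hvec (c 1)) = cosh 1" using hdist_eq_iff[OF h h, of 1 0 1] by simp
  then have "mink (pos x) V = 0" using c(2) h[of 0] by (simp add: V_def mink_linear)
  then obtain \<eta> where \<eta>: "V = tvec (fst x) \<eta>"
    using tvec_surj x unfolding unit_covectors_iff by blast
  have "((\<lambda>t. pt (cosh t *\<^sub>R pos x + sinh t *\<^sub>R V)) has_vector_derivative sharp (fst x) \<eta>) (at 0)"
    by (rule pt_has_vector_derivative[OF orbit_has_vector_derivative])
       (use \<eta> x in \<open>auto simp: unit_covectors_iff\<close>)
  then have "(c has_vector_derivative sharp (fst x) \<eta>) (at 0)"
    using h by (simp flip: lin)
  with c(3) have "sharp (fst x) \<eta> = sharp (fst x) (snd x)"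
    using vector_derivative_unique_at by blast
  then have "\<eta> = snd x" using x by (auto simp: sharp_def unit_covectors_iff hplane_def)
  with \<eta> lin hvec_geo[OF x] have "hvec (c t) = hvec (geo x t)" for t by simp
  then show ?thesis using hvec_inj h geo_in_hplane[OF x] by blast
qed

lemma geodesic_from_eq: "geodesic_from x = geo x" if x: "x \<in> unit_covectors"
proof -
  obtain z \<zeta> where z: "x = (z, \<zeta>)" by (cases x)
  have d: "(geo x has_vector_derivative sharp z \<zeta>) (at 0)"
  proof -
    obtain \<eta> where "tvec z \<eta> = tvec z \<zeta>" "(geo x has_vector_derivative sharp z \<eta>) (at 0)"
      using geo_velocity[OF x, of 0] x by (auto simp: geo_0 z)
    then show ?thesis using tvec_inj x by (auto simp: unit_covectors_iff z)
  qed
  show ?thesis unfolding z geodesic_from_def prod.case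
    by (rule the_equality) (use x d hgeodesic_geo geo_0 hgeodesic_unique z in auto)
qed

lemma hflow:
  assumes x: "x \<in> unit_covectors"
  shows pos_hflow: "pos (hflow t x) = cosh t *\<^sub>R pos x + sinh t *\<^sub>R vel x"
    and vel_hflow: "vel (hflow t x) = sinh t *\<^sub>R pos x + cosh t *\<^sub>R vel x"
    and hflow_unit: "hflow t x \<in> unit_covectors"
    and fst_hflow: "fst (hflow t x) = geo x t"
proof -
  show f: "fst (hflow t x) = geo x t" by (simp add: hflow_def Let_def geodesic_from_eq x)
  obtain \<eta> where \<eta>: "tvec (geo x t) \<eta> = sinh t *\<^sub>R pos x + cosh t *\<^sub>R vel x"
    "(geo x has_vector_derivative sharp (geo x t) \<eta>) (at t)"
    using geo_velocity[OF x] .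
  have "snd (hflow t x) = flat (geo x t) (sharp (geo x t) \<eta>)"
    by (simp add: hflow_def Let_def geodesic_from_eq x vector_derivative_at[OF \<eta>(2)])
  also have "\<dots> = \<eta>" using geo_in_hplane[OF x, of t] by (simp add: flat_def sharp_def hplane_def)
  finally show v: "vel (hflow t x) = sinh t *\<^sub>R pos x + cosh t *\<^sub>R vel x" using f \<eta> by simp
  show p: "pos (hflow t x) = cosh t *\<^sub>R pos x + sinh t *\<^sub>R vel x" by (simp add: f hvec_geo x)
  have "mink (vel (hflow t x)) (vel (hflow t x)) = -1"
    unfolding v using x cosh_square_eq[of t] by (simp add: mink_linear unit_covectors_iff power2_eq_square)
  then show "hflow t x \<in> unit_covectors" using f geo_in_hplane[OF x] by (simp add: unit_covectors_iff)
qed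

section \<open>The action of \<open>SL(2,R)\<close>\<close>

text \<open>The congruence \<open>A ** M ** transpose A\<close>, where \<open>M\<close> has the rows
  \<open>(c, b)\<close> and \<open>(b, a)\<close>.\<close>

definition act :: "real^2^2 \<Rightarrow> vec3 \<Rightarrow> vec3" where
  "act A X = (case X of (a, b, c) \<Rightarrow>
     ((A $ 2 $ 1)\<^sup>2 * c + 2 * A $ 2 $ 1 * A $ 2 $ 2 * b + (A $ 2 $ 2)\<^sup>2 * a,
      A $ 1 $ 1 * A $ 2 $ 1 * c + (A $ 1 $ 1 * A $ 2 $ 2 + A $ 1 $ 2 * A $ 2 $ 1) * b + A $ 1 $ 2 * A $ 2 $ 2 * a,
      (A $ 1 $ 1)\<^sup>2 * c + 2 * A $ 1 $ 1 * A $ 1 $ 2 * b + (A $ 1 $ 2)\<^sup>2 * a))"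

lemma act_linear:
  "act A (X + Y) = act A X + act A Y" "act A (X - Y) = act A X - act A Y"
  "act A (k *\<^sub>R X) = k *\<^sub>R act A X"
  by (simp_all add: act_def split_beta algebra_simps)

lemma act_mult: "act (A ** B) X = act A (act B X)"
  by (cases X)
     (simp add: act_def matrix_matrix_mult_def sum_2 power2_eq_square algebra_simps)

text \<open>Congruence multiplies the determinant, hence also its polarization, by the square of
  \<open>det A\<close>.\<close>

lemma mink_act: "mink (act A X) (act A Y) = mink X Y" if "det A = 1"
proof -
  have "mink (act A X) (act A Y) = (det A)\<^sup>2 * mink X Y"
    by (cases X, cases Y) (simp add: act_def mink_def det_2 power2_eq_square field_simps)
  then show ?thesis using that by simp
qed

lemma moebius_denom_nonzero: "moebius_denom A z \<noteq> 0" if "det A = 1" "z \<in> hplane"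
  using that by (auto simp: moebius_denom_def complex_eq_iff hplane_def det_2)

lemma moebius:
  assumes "det A = 1" "z \<in> hplane"
  shows moebius_in_hplane: "moebius A z \<in> hplane"
    and hvec_moebius: "hvec (moebius A z) = act A (hvec z)"
proof -
  define d n where "d = moebius_denom A z" and "n = of_real (A $ 1 $ 1) * z + of_real (A $ 1 $ 2)"
  have d: "d \<noteq> 0" using assms by (simp add: d_def moebius_denom_nonzero)
  have y: "Im z > 0" using assms by (simp add: hplane_def)
  have m: "moebius A z = n / d" by (simp add: moebius_def d_def n_def)
  have "Im (n * cnj d) = det A * Im z"
    by (simp add: n_def d_def moebius_denom_def det_2 algebra_simps)
  then have i: "Im (n / d) = Im z / (cmod d)\<^sup>2" using assms(1) by (simp add: complex_div_cnj[of n d] Im_divide_of_real)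
  have rr: "Re (n / d) = Re (n * cnj d) / (cmod d)\<^sup>2" by (simp add: complex_div_cnj[of n d] Re_divide_of_real)
  show "moebius A z \<in> hplane" using y d by (simp add: m i hplane_def)
  have "hvec (n / d) = ((cmod d)\<^sup>2 / Im z, Re (n * cnj d) / Im z, (cmod n)\<^sup>2 / Im z)"
    unfolding hvec_def i rr using d y by (simp add: norm_divide power_divide field_simps)
  also have "\<dots> = act A (hvec z)"
    unfolding act_def hvec_def cmod_power2 using y
    by (simp add: n_def d_def moebius_denom_def divide_simps) (simp add: power2_eq_square algebra_simps)
  finally show "hvec (moebius A z) = act A (hvec z)" by (simp add: m)
qed

lemma moebius_cov:
  assumes A: "det A = 1" and z: "fst x \<in> hplane"
  shows pos_moebius_cov: "pos (moebius_cov A x) = act A (pos x)"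
    and vel_moebius_cov: "vel (moebius_cov A x) = act A (vel x)"
proof -
  obtain z \<zeta> where x: "x = (z, \<zeta>)" by (cases x)
  show "pos (moebius_cov A x) = act A (pos x)"
    using assms by (simp add: x moebius_cov_def hvec_moebius)
  define d n where "d = moebius_denom A z" and "n = of_real (A $ 1 $ 1) * z + of_real (A $ 1 $ 2)"
  have d: "d \<noteq> 0" using assms by (simp add: d_def x moebius_denom_nonzero)
  have "vel (moebius_cov A x) = tvec (n / d) (cnj (d\<^sup>2) * \<zeta>)"
    by (simp add: x moebius_cov_def moebius_def d_def n_def)
  \<comment> \<open>The factor by which \<open>moebius_cov\<close> transports covectors clears the
    denominators of the powers of \<open>n / d\<close>.\<close>
  also have "\<dots> = (Im (cnj \<zeta> * d\<^sup>2), Im (cnj \<zeta> * (d * n)), Im (cnj \<zeta> * n\<^sup>2))"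
    using d unfolding tvec_def by (simp add: power2_eq_square mult_ac)
  also have "\<dots> = act A (vel x)"
    by (simp add: x act_def tvec_def d_def n_def moebius_denom_def power2_eq_square algebra_simps)
  finally show "vel (moebius_cov A x) = act A (vel x)" .
qed

lemma moebius_cov_unit: "moebius_cov A x \<in> unit_covectors" if "det A = 1" "x \<in> unit_covectors"
  using that unfolding unit_covectors_iff
  by (simp add: vel_moebius_cov mink_act) (simp add: moebius_cov_def split_beta moebius_in_hplane)

lemma moebius_hflow:
  assumes "det A = 1" "x \<in> unit_covectors"
  shows "fst (hflow t (moebius_cov A x)) = moebius A (fst (hflow t x))"
proof (rule hvec_inj)
  have x: "fst x \<in> hplane" "hflow t x \<in> unit_covectors" "moebius_cov A x \<in> unit_covectors"
    "hflow t (moebius_cov A x) \<in> unit_covectors"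
    using assms by (simp_all add: unit_covectors_iff[of x] hflow_unit moebius_cov_unit)
  then show "fst (hflow t (moebius_cov A x)) \<in> hplane" "moebius A (fst (hflow t x)) \<in> hplane"
    using assms(1) by (simp_all add: unit_covectors_iff moebius_in_hplane)
  have "fst (hflow t x) \<in> hplane" using x by (simp add: unit_covectors_iff)
  then show "pos (hflow t (moebius_cov A x)) = hvec (moebius A (fst (hflow t x)))"
    using assms x by (simp add: hvec_moebius pos_hflow pos_moebius_cov vel_moebius_cov act_linear)
qed

lemma hdist_moebius: "hdist (moebius A z) (moebius A z') = hdist z z'"
  if "det A = 1" "z \<in> hplane" "z' \<in> hplane"
  using that by (simp add: hdist_conv_mink moebius_in_hplane hvec_moebius mink_act)

lemma moebius_mult: "moebius (A ** B) z = moebius A (moebius B z)"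
  if "det A = 1" "det B = 1" "z \<in> hplane"
  by (rule hvec_inj)
    (use that in \<open>simp_all add: moebius_in_hplane hvec_moebius det_mul act_mult\<close>)

lemma moebius_id [simp]: "moebius (mat 1) z = z" "moebius_cov (mat 1) x = x"
  by (simp_all add: moebius_cov_def moebius_def moebius_denom_def mat_def split_beta)

text \<open>The fixed point equation is quadratic with real coefficients, so a matrix that is not
  scalar fixes at most one point of the half plane.\<close>

lemma moebius_fix2:
  assumes A: "det A = 1" and z: "z \<in> hplane" and t: "t \<noteq> 0"
    and fix1: "moebius A z = z" and fix2: "moebius A (z + of_real t) = z + of_real t"
  shows "moebius A z' = z'"
proof -
  have y: "Im z > 0" using z by (simp add: hplane_def)
  \<comment> \<open>The imaginary part of the fixed point equation, divided by \<open>Im u\<close>,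
    and its real part.\<close>
  have *: "A $ 2 $ 1 * (2 * Re u) + (A $ 2 $ 2 - A $ 1 $ 1) = 0 \<and>
      A $ 2 $ 1 * ((Re u)\<^sup>2 - (Im u)\<^sup>2) + (A $ 2 $ 2 - A $ 1 $ 1) * Re u - A $ 1 $ 2 = 0"
    if u: "u \<in> hplane" "moebius A u = u" for u
  proof -
    have "of_real (A $ 1 $ 1) * u + of_real (A $ 1 $ 2) = u * moebius_denom A u"
      using u(2) moebius_denom_nonzero[OF A u(1)] by (simp add: moebius_def field_simps)
    then have e: "A $ 1 $ 1 * Re u + A $ 1 $ 2 = Re (u * moebius_denom A u)"
      "A $ 1 $ 1 * Im u = Im (u * moebius_denom A u)" by (simp_all add: complex_eq_iff)
    have "Im u * (A $ 2 $ 1 * (2 * Re u) + (A $ 2 $ 2 - A $ 1 $ 1)) = 0"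
      using e(2) by (simp add: moebius_denom_def algebra_simps)
    then have "A $ 2 $ 1 * (2 * Re u) + (A $ 2 $ 2 - A $ 1 $ 1) = 0"
      using u(1) by (simp add: hplane_def)
    then show ?thesis using e(1)
      by (simp add: moebius_denom_def power2_eq_square algebra_simps)
  qed
  note 1 = *[OF z fix1]
  have "z + of_real t \<in> hplane" using y by (simp add: hplane_def)
  note 2 = *[OF this fix2]
  have "A $ 2 $ 1 * t = 0" using 1 2 by (simp add: algebra_simps)
  then have c: "A $ 2 $ 1 = 0" using t by simp
  then have "A $ 2 $ 2 = A $ 1 $ 1" using 1 by simp
  moreover from this have "A $ 1 $ 2 = 0" using 1 c by simp
  moreover have "A $ 1 $ 1 \<noteq> 0" using A c by (auto simp: det_2)
  ultimately show ?thesis using c by (simp add: moebius_def moebius_denom_def)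
qed

section \<open>The orbit of the centre\<close>

lemma group_SL2R: "group SL2R"
proof (rule groupI)
  fix A assume "A \<in> carrier SL2R"
  then have A: "det A = 1" by (simp add: SL2R_def)
  then have "invertible A" by (simp add: invertible_det_nz)
  then obtain B where i: "B ** A = mat 1" by (auto simp: invertible_def)
  then have "det B * det A = 1" by (metis det_I det_mul)
  then show "\<exists>B\<in>carrier SL2R. B \<otimes>\<^bsub>SL2R\<^esub> A = \<one>\<^bsub>SL2R\<^esub>"
    using A i by (intro bexI[of _ B]) (simp_all add: SL2R_def)
qed (simp_all add: SL2R_def det_mul matrix_mul_assoc)

lemma minus_mat_mult: "(- mat 1) ** A = - A" "A ** (- mat 1) = - A" for A :: "real^2^2"
  by (simp_all add: vec_eq_iff matrix_matrix_mult_def mat_def forall_2 sum_2)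

lemma normal_center: "{mat 1, - mat 1} \<lhd> SL2R"
proof -
  interpret group SL2R by (rule group_SL2R)
  have d: "det (- mat 1 :: real^2^2) = 1" by (simp add: det_2 mat_def)
  have s: "subgroup {mat 1, - mat 1} SL2R"
  proof (rule subgroupI)
    fix a assume a: "a \<in> {mat 1, - mat 1 :: real^2^2}"
    then have "inv\<^bsub>SL2R\<^esub> a = a"
      by (intro inv_equality) (use d in \<open>auto simp: SL2R_def minus_mat_mult\<close>)
    with a show "inv\<^bsub>SL2R\<^esub> a \<in> {mat 1, - mat 1}" by simp
  qed (use d in \<open>auto simp: SL2R_def minus_mat_mult\<close>)
  then show ?thesis
    by (rule normalI) (auto simp: r_coset_def l_coset_def SL2R_def minus_mat_mult)
qed

text \<open>Passes from the group of cosets to the group of all matrices in them, so that orbits can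
  be handled with matrix products.\<close>

lemma fuchsian_matrices:
  assumes "fuchsian \<Gamma>"
  shows fuchsian_det: "A \<in> \<Union>\<Gamma> \<Longrightarrow> det A = 1"
    and fuchsian_mult: "A \<in> \<Union>\<Gamma> \<Longrightarrow> B \<in> \<Union>\<Gamma> \<Longrightarrow> A ** B \<in> \<Union>\<Gamma>"
    and fuchsian_id: "mat 1 \<in> \<Union>\<Gamma>"
    and fuchsian_inv: "A \<in> \<Union>\<Gamma> \<Longrightarrow> \<exists>B\<in>\<Union>\<Gamma>. B ** A = mat 1"
proof -
  let ?H = "{mat 1, - mat 1 :: real^2^2}"
  interpret group SL2R by (rule group_SL2R)
  interpret normal ?H SL2R by (rule normal_center)
  have sub: "subgroup \<Gamma> PSL2R" using assms by (simp add: fuchsian_def)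
  have carr: "X \<in> rcosets\<^bsub>SL2R\<^esub> ?H" if "X \<in> \<Gamma>" for X
    using subgroup.mem_carrier[OF sub that] by (simp add: PSL2R_def FactGroup_def)
  have one: "?H \<in> \<Gamma>" using subgroup.one_closed[OF sub] by (simp add: PSL2R_def FactGroup_def)
  show id: "mat 1 \<in> \<Union>\<Gamma>" using one by blast
  have in_SL: "X \<subseteq> carrier SL2R" if "X \<in> \<Gamma>" for X
    using rcosets_carrier[OF is_group carr[OF that]] .
  then show det: "det A = 1" if "A \<in> \<Union>\<Gamma>" for A
    using that by (auto simp: SL2R_def)
  show mult: "A ** B \<in> \<Union>\<Gamma>" if AB: "A \<in> \<Union>\<Gamma>" "B \<in> \<Union>\<Gamma>" for A B
  proof -
    obtain X Y where XY: "X \<in> \<Gamma>" "Y \<in> \<Gamma>" "A \<in> X" "B \<in> Y" using AB by blast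
    have "X <#>\<^bsub>SL2R\<^esub> Y \<in> \<Gamma>"
      using subgroup.m_closed[OF sub XY(1,2)] by (simp add: PSL2R_def FactGroup_def)
    moreover have "A ** B \<in> X <#>\<^bsub>SL2R\<^esub> Y" using XY by (auto simp: set_mult_def SL2R_def)
    ultimately show ?thesis by blast
  qed
  show "\<exists>B\<in>\<Union>\<Gamma>. B ** A = mat 1" if A: "A \<in> \<Union>\<Gamma>" for A
  proof -
    obtain X where X: "X \<in> \<Gamma>" "A \<in> X" using A by blast
    have inv: "inv\<^bsub>PSL2R\<^esub> X \<in> \<Gamma>" using subgroup.m_inv_closed[OF sub X(1)] .
    have Y: "inv\<^bsub>PSL2R\<^esub> X = set_inv\<^bsub>SL2R\<^esub> X"
      unfolding PSL2R_def by (rule inv_FactGroup) (simp add: FactGroup_def carr X)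
    have "inv\<^bsub>SL2R\<^esub> A \<in> \<Union>\<Gamma>" using inv X(2) unfolding Y by (auto simp: SET_INV_def)
    moreover have "inv\<^bsub>SL2R\<^esub> A \<otimes>\<^bsub>SL2R\<^esub> A = \<one>\<^bsub>SL2R\<^esub>"
      using in_SL X by (intro l_inv) auto
    ultimately show ?thesis by (auto simp: SL2R_def)
  qed
qed

text \<open>The radius \<open>R\<close> replaces the supremum in \<open>inj_radius\<close>. Its
  margin \<open>R - r\<close> separates the lifts of the circle from one another and limits how soon
  a geodesic can change from one to another.\<close>

locale embedded_circle =
  fixes \<Gamma> :: "(real^2^2) set set" and w :: complex and r R :: real
  assumes fuchsian: "fuchsian \<Gamma>" and w: "w \<in> hplane" and r: "0 < r" "r < R"
    and inj: "inj_on (proj \<Gamma>) {z \<in> hplane. hdist w z < R}"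
begin

abbreviation "circle \<equiv> distance_circle \<Gamma> w r"

lemma R: "0 < R" using r by simp

lemmas G_det = fuchsian_det[OF fuchsian]
lemmas G_mult = fuchsian_mult[OF fuchsian]
lemmas G_id = fuchsian_id[OF fuchsian]

lemma G_inv:
  assumes "A \<in> \<Union>\<Gamma>"
  obtains B where "B \<in> \<Union>\<Gamma>" "\<And>z. z \<in> hplane \<Longrightarrow> moebius B (moebius A z) = z"
    "\<And>z. z \<in> hplane \<Longrightarrow> moebius A (moebius B z) = z"
proof -
  obtain B where B: "B \<in> \<Union>\<Gamma>" "B ** A = mat 1" using fuchsian_inv[OF fuchsian assms] by blast
  then have "A ** B = mat 1" using matrix_left_right_inverse by blast
  have "det A = 1" "det B = 1" using assms B G_det by blast+
  then have "moebius B (moebius A z) = z" "moebius A (moebius B z) = z" if "z \<in> hplane" for z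
    using moebius_mult[of B A z] moebius_mult[of A B z] B(2) \<open>A ** B = mat 1\<close> that by simp_all
  with B(1) show ?thesis by (rule that)
qed

lemma proj_in_hplane: "u \<in> proj \<Gamma> z \<Longrightarrow> z \<in> hplane \<Longrightarrow> u \<in> hplane"
  unfolding proj_def using G_det moebius_in_hplane by blast

lemma proj_self: "z \<in> proj \<Gamma> z"
  unfolding proj_def using G_id by (metis image_eqI moebius_id(1))

lemma proj_moebius_mem:
  assumes "A \<in> \<Union>\<Gamma>" "u \<in> proj \<Gamma> z" "z \<in> hplane"
  shows "moebius A u \<in> proj \<Gamma> z"
proof -
  obtain B where B: "B \<in> \<Union>\<Gamma>" "u = moebius B z" using assms(2) by (auto simp: proj_def)
  then have "moebius A u = moebius (A ** B) z" using assms by (simp add: moebius_mult G_det)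
  then show ?thesis using G_mult[OF assms(1) B(1)] by (auto simp: proj_def)
qed

lemma proj_moebius: "proj \<Gamma> (moebius A z) = proj \<Gamma> z" if A: "A \<in> \<Union>\<Gamma>" and z: "z \<in> hplane"
proof -
  have sub: "proj \<Gamma> (moebius A z) \<subseteq> proj \<Gamma> z" if A: "A \<in> \<Union>\<Gamma>" and z: "z \<in> hplane" for A z
    using proj_moebius_mem[OF _ proj_moebius_mem[OF A proj_self z] z] unfolding proj_def by blast
  obtain B where B: "B \<in> \<Union>\<Gamma>" "moebius B (moebius A z) = z" using G_inv[OF A] z by metis
  have "moebius A z \<in> hplane" using A z G_det moebius_in_hplane by blast
  from sub[OF B(1) this] sub[OF A z] B(2) show ?thesis by simp
qed

text \<open>The stabilizer of a point of the ball also fixes a neighbourhood of this point.\<close>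

lemma orbit_separated:
  assumes z1: "z1 \<in> proj \<Gamma> w" and z2: "z2 \<in> proj \<Gamma> w" and q: "q \<in> hplane"
    and "hdist z1 q < R" "hdist z2 q < R"
  shows "z1 = z2"
proof -
  obtain A where A: "A \<in> \<Union>\<Gamma>" "z1 = moebius A w" using z1 by (auto simp: proj_def)
  obtain A' where A': "A' \<in> \<Union>\<Gamma>" "\<And>z. z \<in> hplane \<Longrightarrow> moebius A' (moebius A z) = z"
    "\<And>z. z \<in> hplane \<Longrightarrow> moebius A (moebius A' z) = z" using G_inv[OF A(1)] by metis
  have z2h: "z2 \<in> hplane" and z1h: "z1 \<in> hplane" using z1 z2 w proj_in_hplane by blast+
  \<comment> \<open>Injectivity is known only around \<open>w\<close>, so \<open>A'\<close> moves
    \<open>z1\<close> to \<open>w\<close> first.\<close>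
  define u where "u = moebius A' z2"
  have uh: "u \<in> hplane" using A' z2h by (simp add: u_def G_det moebius_in_hplane)
  have "u \<in> proj \<Gamma> w" unfolding u_def using A'(1) z2 w by (rule proj_moebius_mem)
  then obtain C where C: "C \<in> \<Union>\<Gamma>" "u = moebius C w" by (auto simp: proj_def)
  obtain D where D: "D \<in> \<Union>\<Gamma>" "moebius D u = w" using G_inv[OF C(1)] C(2) w by metis
  define q0 where "q0 = moebius A' q"
  have q0: "q0 \<in> hplane" using A' q by (simp add: q0_def G_det moebius_in_hplane)
  have dq: "hdist w q0 < R" "hdist u q0 < R"
    using hdist_moebius[of A' z1 q] hdist_moebius[of A' z2 q] A' assms w z1h z2h
    by (simp_all add: A(2) G_det q0_def u_def)
  \<comment> \<open>\<open>D\<close> turns distances from \<open>u\<close> into distances from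
    \<open>w\<close>, so \<open>p\<close> and \<open>D p\<close> are points of one orbit in the ball
    around \<open>w\<close>.\<close>
  have fixed: "moebius D p = p" if p: "p \<in> hplane" "hdist w p < R" "hdist u p < R" for p
  proof (rule inj_onD[OF inj])
    show "proj \<Gamma> (moebius D p) = proj \<Gamma> p" using D p by (simp add: proj_moebius)
    have "hdist w (moebius D p) = hdist u p" using hdist_moebius[of D u p] D uh p by (simp add: G_det)
    then show "moebius D p \<in> {z \<in> hplane. hdist w z < R}" using D p by (simp add: G_det moebius_in_hplane)
  qed (use p in simp)
  define f where "f v t = mink (hvec v) (hvec (q0 + of_real t))" for v and t :: real
  have qt: "q0 + of_real t \<in> hplane" for t using q0 by (simp add: hplane_def)
  have lim: "(f v \<longlongrightarrow> f v 0) (at_right 0)" for v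
    unfolding f_def mink_def hvec_def by (intro tendsto_eq_intros refl) (use q0 in \<open>auto simp: hplane_def\<close>)
  \<comment> \<open>A small horizontal translate of \<open>q0\<close> stays in both balls and serves
    as the second fixed point of \<open>D\<close>.\<close>
  have "\<forall>\<^sub>F t in at_right 0. f w t < cosh R \<and> f u t < cosh R \<and> t > 0"
    using dq w uh q0 R
    by (intro eventually_conj order_tendstoD(2)[OF lim] eventually_at_right_less)
       (simp_all add: f_def hdist_less_iff)
  then obtain t where "f w t < cosh R" "f u t < cosh R" "t > 0"
    using eventually_happens trivial_limit_at_right_real by blast
  then have "moebius D (q0 + of_real t) = q0 + of_real t" "t \<noteq> 0"
    using fixed[OF qt, of t] w uh qt R by (simp_all add: f_def hdist_less_iff)
  then have "moebius D u = u"
    using moebius_fix2[of D q0 t] D(1) q0 fixed[OF q0] dq by (simp add: G_det)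
  then have "u = w" using D by simp
  then show ?thesis using A A' z2h by (metis u_def)
qed

text \<open>The balls of radius \<open>R\<close> around the orbit points are open, nonempty and
  pairwise disjoint.\<close>

lemma countable_orbit: "countable (proj \<Gamma> w)"
proof -
  define B where "B z = {q. 0 < Im q \<and> mink (hvec z) (hvec q) < cosh R}" for z
  have B: "q \<in> B z \<longleftrightarrow> q \<in> hplane \<and> hdist z q < R" if "z \<in> proj \<Gamma> w" for z q
    using R proj_in_hplane[OF that w] by (auto simp: B_def hdist_less_iff hplane_def)
  have self: "z \<in> B z" if "z \<in> proj \<Gamma> w" for z
    using B[OF that] R proj_in_hplane[OF that w] by (simp add: hdist_def)
  have "open (B z)" for z
  proof -
    have "open {q. 0 < Im q}" by (simp add: open_halfspace_Im_gt)
    moreover have "continuous_on {q. 0 < Im q} (\<lambda>q. mink (hvec z) (hvec q))"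
    proof -
      obtain a b c where z: "hvec z = (a, b, c)" by (cases "hvec z")
      show ?thesis unfolding mink_def z unfolding hvec_def by (auto intro!: continuous_intros)
    qed
    ultimately have "open ({q. 0 < Im q} \<inter> (\<lambda>q. mink (hvec z) (hvec q)) -` {..<cosh R})"
      by (intro continuous_open_preimage) auto
    also have "{q. 0 < Im q} \<inter> (\<lambda>q. mink (hvec z) (hvec q)) -` {..<cosh R} = B z" by (auto simp: B_def)
    finally show ?thesis .
  qed
  moreover have dis: "z1 = z2" if "z1 \<in> proj \<Gamma> w" "z2 \<in> proj \<Gamma> w" "q \<in> B z1" "q \<in> B z2" for z1 z2 q
    using orbit_separated[of z1 z2 q] that by (simp add: B)
  ultimately have "countable (B ` proj \<Gamma> w)"
    by (intro countable_disjoint_open_subsets) (auto simp: pairwise_def disjnt_iff)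
  moreover have "inj_on B (proj \<Gamma> w)" by (rule inj_onI) (use self dis in metis)
  ultimately show ?thesis by (rule countable_image_inj_on)
qed

section \<open>Distances on the surface and distances from orbit points\<close>

lemma orbit_hdist:
  assumes "z1 \<in> proj \<Gamma> w" "z2 \<in> proj \<Gamma> z" "z \<in> hplane"
  obtains z3 where "z3 \<in> proj \<Gamma> w" "hdist z1 z2 = hdist z3 z"
proof -
  obtain A where A: "A \<in> \<Union>\<Gamma>" "z2 = moebius A z" using assms(2) by (auto simp: proj_def)
  obtain B where B: "B \<in> \<Union>\<Gamma>" "moebius B z2 = z" using G_inv[OF A(1)] A(2) assms(3) by metis
  show ?thesis
  proof (rule that[of "moebius B z1"])
    show "moebius B z1 \<in> proj \<Gamma> w" using proj_moebius_mem B assms w by blast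
    show "hdist z1 z2 = hdist (moebius B z1) z"
      using hdist_moebius[of B z1 z2] B assms w proj_in_hplane by (simp add: G_det)
  qed
qed

text \<open>Any competing pair can be moved so that it ends at \<open>z\<close>; if it is closer
  than \<open>R\<close>, its orbit point must be \<open>z1\<close>.\<close>

lemma surf_dist_eq:
  assumes z1: "z1 \<in> proj \<Gamma> w" and z: "z \<in> hplane" and "hdist z1 z < R"
  shows "surf_dist (proj \<Gamma> w) (proj \<Gamma> z) = hdist z1 z"
  unfolding surf_dist_def
proof (rule cInf_eq_minimum)
  show "hdist z1 z \<in> {hdist a b |a b. a \<in> proj \<Gamma> w \<and> b \<in> proj \<Gamma> z}"
    using z1 proj_self[of z] by blast
  fix d assume "d \<in> {hdist a b |a b. a \<in> proj \<Gamma> w \<and> b \<in> proj \<Gamma> z}"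
  then obtain a b where "a \<in> proj \<Gamma> w" "b \<in> proj \<Gamma> z" "d = hdist a b" by blast
  then obtain z3 where z3: "z3 \<in> proj \<Gamma> w" "d = hdist z3 z" using orbit_hdist[of a b z] z by metis
  have "z3 = z1" if "d < R" using orbit_separated[OF z3(1) z1 z] that z3(2) assms(3) by simp
  then show "hdist z1 z \<le> d" using z3(2) assms(3) by (cases "d < R") simp_all
qed

lemma proj_in_circle_iff:
  assumes z: "z \<in> hplane"
  shows "proj \<Gamma> z \<in> circle \<longleftrightarrow> (\<exists>z1\<in>proj \<Gamma> w. hdist z1 z = r)"
proof
  let ?D = "{hdist a b |a b. a \<in> proj \<Gamma> w \<and> b \<in> proj \<Gamma> z}"
  assume "proj \<Gamma> z \<in> circle"
  then have d: "surf_dist (proj \<Gamma> w) (proj \<Gamma> z) = r" by (simp add: distance_circle_def)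
  have "?D \<noteq> {}" using proj_self[of w] proj_self[of z] by blast
  \<comment> \<open>The room between \<open>r\<close> and \<open>R\<close> supplies a pair closer
    than \<open>R\<close> before the infimum is known to be attained.\<close>
  moreover have "Inf ?D < R" using d r by (simp only: surf_dist_def)
  ultimately have "\<exists>d\<in>?D. d < R" by (rule cInf_lessD)
  then obtain a b where "a \<in> proj \<Gamma> w" "b \<in> proj \<Gamma> z" "hdist a b < R" by blast
  then obtain z3 where z3: "z3 \<in> proj \<Gamma> w" "hdist z3 z < R" using orbit_hdist[of a b z] z by metis
  then have "hdist z3 z = r" using surf_dist_eq[OF z3(1) z z3(2)] d by simp
  with z3(1) show "\<exists>z1\<in>proj \<Gamma> w. hdist z1 z = r" by blast
next
  assume "\<exists>z1\<in>proj \<Gamma> w. hdist z1 z = r"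
  then obtain z1 where z1: "z1 \<in> proj \<Gamma> w" "hdist z1 z = r" by blast
  with surf_dist_eq[OF z1(1) z] r have "surf_dist (proj \<Gamma> w) (proj \<Gamma> z) = r" by simp
  then show "proj \<Gamma> z \<in> circle" using z by (simp add: distance_circle_def surface_def)
qed

end

section \<open>Return times\<close>

lemma forward_return_nonneg: "0 \<le> forward_return \<Gamma> H n X"
proof (induction n)
  case (Suc n)
  have "0 \<le> ereal t" if "forward_return \<Gamma> H n X < ereal t" for t
    using order.strict_trans1[OF Suc that] by (rule order.strict_implies_order)
  then show ?case unfolding forward_return.simps by (intro Inf_greatest) blast
qed simp

lemma backward_return_nonpos: "backward_return \<Gamma> H n X \<le> 0"
proof (induction n)
  case (Suc n)
  have "ereal t \<le> 0" if "ereal t < backward_return \<Gamma> H n X" for t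
    using order.strict_trans2[OF that Suc] by (rule order.strict_implies_order)
  then show ?case unfolding backward_return.simps by (intro Sup_least) blast
qed simp

text \<open>All that is retained of the counting of returns: for either sign of \<open>j\<close>,
  nonzero meeting times arbitrarily close to \<open>T\<close>.\<close>

lemma return_time_approx:
  assumes j: "j \<noteq> 0" and T: "return_time \<Gamma> H j X = ereal T" and \<epsilon>: "0 < \<epsilon>"
  shows "\<exists>t. t \<noteq> 0 \<and> gflow t X \<in> cosphere_over \<Gamma> H \<and> \<bar>t - T\<bar> < \<epsilon>"
proof (cases "j > 0")
  case True
  then obtain n where n: "nat j = Suc n" by (cases "nat j") simp_all
  let ?A = "{ereal t | t. forward_return \<Gamma> H n X < ereal t \<and> gflow t X \<in> cosphere_over \<Gamma> H}"
  have A: "Inf ?A = ereal T" using T True n by (simp add: return_time_def)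
  then have "Inf ?A < ereal (T + \<epsilon>)" using \<epsilon> by simp
  then obtain t where t: "forward_return \<Gamma> H n X < ereal t" "gflow t X \<in> cosphere_over \<Gamma> H" "t < T + \<epsilon>"
    unfolding Inf_less_iff by auto
  have "Inf ?A \<le> ereal t" by (rule Inf_lower) (use t in blast)
  then have "T \<le> t" using A by simp
  moreover have "0 < t" using order.strict_trans1[OF forward_return_nonneg t(1)] by simp
  ultimately show ?thesis using t by (intro exI[of _ t]) simp
next
  case False
  then obtain n where n: "nat (- j) = Suc n" using j by (cases "nat (- j)") simp_all
  let ?A = "{ereal t | t. ereal t < backward_return \<Gamma> H n X \<and> gflow t X \<in> cosphere_over \<Gamma> H}"
  have A: "Sup ?A = ereal T" using T False j n by (simp add: return_time_def)
  then have "ereal (T - \<epsilon>) < Sup ?A" using \<epsilon> by simp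
  then obtain t where t: "ereal t < backward_return \<Gamma> H n X" "gflow t X \<in> cosphere_over \<Gamma> H" "T - \<epsilon> < t"
    unfolding less_Sup_iff by auto
  have "ereal t \<le> Sup ?A" by (rule Sup_upper) (use t in blast)
  then have "t \<le> T" using A by simp
  moreover have "t < 0" using order.strict_trans2[OF t(1) backward_return_nonpos] by simp
  ultimately show ?thesis using t by (intro exI[of _ t]) simp
qed

section \<open>Circles and reflection\<close>

lemma spacelike:
  assumes "z \<in> hplane" "mink (hvec z) X = 0"
  shows "mink X X \<le> 0"
proof -
  obtain \<zeta> where "X = tvec z \<zeta>" using tvec_surj[OF assms] .
  then show ?thesis by (simp add: mink_tvec)
qed

text \<open>Bounds the rate at which \<open>cosh\<close> of the distance from \<open>z\<close>
  changes along a geodesic.\<close>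

lemma mink_vel_bound:
  assumes y: "y \<in> unit_covectors" and z: "z \<in> hplane" and p: "mink (hvec z) (pos y) = cosh r"
  shows "\<bar>mink (hvec z) (vel y)\<bar> \<le> \<bar>sinh r\<bar>"
proof -
  define u where "u = mink (hvec z) (vel y)"
  have y': "fst y \<in> hplane" "mink (vel y) (vel y) = -1" using y by (simp_all add: unit_covectors_iff)
  \<comment> \<open>The component of \<open>hvec z\<close> orthogonal to position and velocity; the
    plus sign arises because \<open>vel y\<close> has square -1.\<close>
  define X where "X = hvec z - cosh r *\<^sub>R pos y + u *\<^sub>R vel y"
  have c: "mink (pos y) (hvec z) = cosh r" "mink (vel y) (hvec z) = u"
    using p by (simp_all add: u_def mink_commute)
  have "mink X X \<le> 0"
    by (rule spacelike[OF y'(1)]) (use y' c in \<open>simp add: X_def mink_linear\<close>)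
  moreover have "mink X X = u\<^sup>2 - (sinh r)\<^sup>2"
    unfolding X_def mink_linear c p u_def[symmetric] y'(2) mink_hvec_self[OF y'(1)] mink_hvec_self[OF z]
      mink_hvec_tvec
    using cosh_square_eq[of r] by (simp add: power2_eq_square algebra_simps)
  ultimately show ?thesis by (simp add: abs_le_square_iff flip: u_def)
qed

text \<open>The Euclidean centre of the hyperbolic circle of radius \<open>\<rho>\<close> around \<open>z\<close>.\<close>

definition ecenter :: "complex \<Rightarrow> real \<Rightarrow> complex" where
  "ecenter z \<rho> = Complex (Re z) (Im z * cosh \<rho>)"

lemma hdist_eq_iff_euclidean:
  assumes "z1 \<in> hplane" "z \<in> hplane" "0 \<le> \<rho>"
  shows "hdist z1 z = \<rho> \<longleftrightarrow> inner (z - ecenter z1 \<rho>) (z - ecenter z1 \<rho>) = (Im z1 * sinh \<rho>)\<^sup>2"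
proof -
  have y: "Im z > 0" "Im z1 > 0" using assms by (auto simp: hplane_def)
  have "hdist z1 z = \<rho> \<longleftrightarrow> (cmod (z1 - z))\<^sup>2 = 2 * Im z1 * Im z * (cosh \<rho> - 1)"
    using y by (simp add: hdist_eq_iff assms mink_hvec field_simps)
  also have "\<dots> \<longleftrightarrow> inner (z - ecenter z1 \<rho>) (z - ecenter z1 \<rho>) = (Im z1)\<^sup>2 * ((cosh \<rho>)\<^sup>2 - 1)"
    unfolding cmod_power2 by (simp add: ecenter_def inner_complex_def power2_eq_square algebra_simps)
  finally show ?thesis by (simp add: cosh_square_eq power_mult_distrib)
qed

lemma euclidean_circle_in_hplane:
  assumes z1: "z1 \<in> hplane" and "0 \<le> \<rho>"
    and z: "inner (z - ecenter z1 \<rho>) (z - ecenter z1 \<rho>) = (Im z1 * sinh \<rho>)\<^sup>2"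
  shows "z \<in> hplane"
proof -
  have y: "Im z1 > 0" using z1 by (simp add: hplane_def)
  have "(cmod (z - ecenter z1 \<rho>))\<^sup>2 = (Im z1 * sinh \<rho>)\<^sup>2" using z by (simp add: power2_norm_eq_inner)
  then have "cmod (z - ecenter z1 \<rho>) = Im z1 * sinh \<rho>"
    using y assms(2) by (simp add: power2_eq_iff_nonneg)
  then have "\<bar>Im z - Im z1 * cosh \<rho>\<bar> \<le> Im z1 * sinh \<rho>"
    using abs_Im_le_cmod[of "z - ecenter z1 \<rho>"] by (simp add: ecenter_def)
  moreover have "Im z1 * sinh \<rho> < Im z1 * cosh \<rho>" using y cosh_gt_abs_sinh[of \<rho>] by simp
  ultimately show ?thesis by (simp add: hplane_def)
qed

text \<open>The Euclidean normal of the circle becomes a multiple of the centre projected to the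
  tangent plane.\<close>

lemma tvec_radial:
  assumes z1: "z1 \<in> hplane" and z: "z \<in> hplane" and "mink (hvec z1) (hvec z) = cosh \<rho>"
  shows "tvec z (z - ecenter z1 \<rho>) = - (Im z * Im z1) *\<^sub>R (hvec z1 - cosh \<rho> *\<^sub>R hvec z)"
proof (rule tvec_eqI[OF z])
  show "mink (hvec z) (- (Im z * Im z1) *\<^sub>R (hvec z1 - cosh \<rho> *\<^sub>R hvec z)) = 0"
    unfolding mink_linear using assms by (simp add: mink_commute[of "hvec z" "hvec z1"])
  show "mink (hvec z) (tvec z (z - ecenter z1 \<rho>)) = 0" by simp
  have y: "Im z > 0" "Im z1 > 0" using z z1 by (auto simp: hplane_def)
  show "fst (tvec z (z - ecenter z1 \<rho>)) = fst (- (Im z * Im z1) *\<^sub>R (hvec z1 - cosh \<rho> *\<^sub>R hvec z))"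
    using y by (simp add: tvec_def hvec_def ecenter_def right_diff_distrib)
  show "fst (snd (tvec z (z - ecenter z1 \<rho>))) = fst (snd (- (Im z * Im z1) *\<^sub>R (hvec z1 - cosh \<rho> *\<^sub>R hvec z)))"
    using y by (simp add: tvec_def hvec_def ecenter_def right_diff_distrib) (simp add: algebra_simps)
qed

lemma inner_decomposition:
  "of_real (inner \<zeta> m) * m + of_real (inner \<zeta> (\<i> * m)) * (\<i> * m) = of_real (inner m m) * \<zeta>"
  for \<zeta> m :: complex
  by (simp add: complex_eq_iff inner_complex_def algebra_simps)

lemma geo_hflow: "geo (hflow t x) h = geo x (t + h)" if "x \<in> unit_covectors"
  using that
  by (intro hvec_inj) (simp_all add: hvec_geo geo_in_hplane hflow_unit pos_hflow vel_hflow
      cosh_add sinh_add algebra_simps)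

section \<open>Reflection at the lifts of the circle\<close>

context embedded_circle
begin

text \<open>For small times a curve over the circle is closer than \<open>R\<close> to
  \<open>z1\<close>, so it cannot be on any other lift and runs in one Euclidean circle.\<close>

lemma tangent_space_circle:
  assumes z1: "z1 \<in> proj \<Gamma> w" and z: "z \<in> hplane" and d: "hdist z1 z = r"
  shows "tangent_space \<Gamma> circle z = {v. inner v (z - ecenter z1 r) = 0}"
proof -
  define m where "m = z - ecenter z1 r"
  have z1h: "z1 \<in> hplane" using z1 w by (rule proj_in_hplane)
  have r0: "0 \<le> r" using r by simp
  have mm: "inner m m = (Im z1 * sinh r)\<^sup>2"
    using hdist_eq_iff_euclidean[OF z1h z r0] d by (simp add: m_def)
  then have m0: "inner m m \<noteq> 0" using r z1h by (simp add: hplane_def)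
  have "v \<in> tangent_space \<Gamma> circle z \<longleftrightarrow> inner v m = 0" for v
  proof
    assume "v \<in> tangent_space \<Gamma> circle z"
    then obtain c :: "real \<Rightarrow> complex" where c': "\<forall>t. c t \<in> hplane \<and> proj \<Gamma> (c t) \<in> circle" "c 0 = z"
      "(c has_vector_derivative v) (at 0)"
      unfolding tangent_space_def by (elim CollectE exE conjE) (rule that)
    then have c: "\<And>t. c t \<in> hplane" "\<And>t. proj \<Gamma> (c t) \<in> circle" "c 0 = z"
      "(c has_vector_derivative v) (at 0)" by blast+
    have "isCont c 0" using has_vector_derivative_continuous c(4) by blast
    \<comment> \<open>The filter \<open>nhds 0\<close> contains the point 0 itself, as the later
      comparison of derivatives requires.\<close>
    then have lc: "(c \<longlongrightarrow> z) (nhds 0)"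
      using c(3) tendsto_at_iff_tendsto_nhds[of c 0] by (simp add: isCont_def)
    obtain a b e where h: "hvec z1 = (a, b, e)" by (cases "hvec z1")
    have "((\<lambda>t. mink (hvec z1) (hvec (c t))) \<longlongrightarrow> mink (hvec z1) (hvec z)) (nhds 0)"
      unfolding mink_def h unfolding hvec_def
      by (intro tendsto_intros lc) (use z in \<open>simp_all add: hplane_def\<close>)
    moreover have "mink (hvec z1) (hvec z) < cosh R"
      using d r z R hdist_less_iff[OF z1h z, of R] by simp
    ultimately have "\<forall>\<^sub>F t in nhds 0. mink (hvec z1) (hvec (c t)) < cosh R" by (rule order_tendstoD)
    then have ev: "\<forall>\<^sub>F t in nhds 0. inner (c t - ecenter z1 r) (c t - ecenter z1 r) = (Im z1 * sinh r)\<^sup>2"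
    proof eventually_elim
      case (elim t)
      then have 1: "hdist z1 (c t) < R" using hdist_less_iff[OF z1h c(1)] R by simp
      obtain z2 where z2: "z2 \<in> proj \<Gamma> w" "hdist z2 (c t) = r"
        using c(2)[of t] proj_in_circle_iff[OF c(1)[of t]] by blast
      then have "z2 = z1" using orbit_separated[OF z2(1) z1 c(1)[of t]] 1 r by simp
      then show ?case using hdist_eq_iff_euclidean[OF z1h c(1) r0] z2 by simp
    qed
    have "((\<lambda>t. inner (c t - ecenter z1 r) (c t - ecenter z1 r)) has_vector_derivative
        inner m (v - 0) + inner (v - 0) m) (at 0)"
      unfolding m_def
      by (rule has_vector_derivative_eq_rhs)
         (rule bounded_bilinear.has_vector_derivative[OF bounded_bilinear_inner]
           has_vector_derivative_diff c has_vector_derivative_const | simp add: c)+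
    then have "((\<lambda>t. inner (c t - ecenter z1 r) (c t - ecenter z1 r)) has_real_derivative
        2 * inner v m) (at 0)"
      by (simp add: has_real_derivative_iff_has_vector_derivative inner_commute)
    then have "((\<lambda>t. (Im z1 * sinh r)\<^sup>2) has_real_derivative 2 * inner v m) (at (0::real))"
      using DERIV_cong_ev[OF refl ev refl] by blast
    then have "2 * inner v m = 0" by (rule DERIV_unique) simp
    then show "inner v m = 0" by simp
  next
    assume v: "inner v m = 0"
    define k where "k = inner v (\<i> * m) / inner m m"
    have vk: "v = of_real k * (\<i> * m)"
      using inner_decomposition[of v m] v m0 by (simp add: k_def field_simps)
    \<comment> \<open>\<open>tangent_space\<close> demands a curve over the circle for all times,
      hence a rotation about the Euclidean centre instead of a line.\<close>
    define c where "c t = ecenter z1 r + m * cis (k * t)" for t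
    have i: "inner (c t - ecenter z1 r) (c t - ecenter z1 r) = (Im z1 * sinh r)\<^sup>2" for t
      unfolding mm[symmetric] by (simp add: c_def norm_mult flip: power2_norm_eq_inner)
    have ch: "c t \<in> hplane" for t by (rule euclidean_circle_in_hplane[OF z1h r0 i])
    have "proj \<Gamma> (c t) \<in> circle" for t
      using hdist_eq_iff_euclidean[OF z1h ch r0] i z1 proj_in_circle_iff[OF ch] by blast
    moreover have "(c has_vector_derivative v) (at 0)"
      unfolding c_def vk has_vector_derivative_complex_iff
      by (auto intro!: derivative_eq_intros)
    moreover have "c 0 = z" by (simp add: c_def m_def)
    ultimately show "v \<in> tangent_space \<Gamma> circle z"
      unfolding tangent_space_def by (intro CollectI exI[of _ c] conjI allI ch)
  qed
  then show ?thesis by (auto simp: m_def)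
qed

lemma hreflect_circle:
  assumes z1: "z1 \<in> proj \<Gamma> w" and z: "z \<in> hplane" and d: "hdist z1 z = r"
  defines "m \<equiv> z - ecenter z1 r"
  shows "hreflect \<Gamma> circle (z, \<zeta>) = (z, \<zeta> - of_real (2 * inner \<zeta> m / inner m m) * m)"
proof -
  have z1h: "z1 \<in> hplane" using z1 w by (rule proj_in_hplane)
  have "inner m m = (Im z1 * sinh r)\<^sup>2"
    using hdist_eq_iff_euclidean[OF z1h z, of r] r d by (simp add: m_def)
  then have m0: "inner m m \<noteq> 0" using r z1h by (simp add: hplane_def)
  let ?\<zeta> = "\<zeta> - of_real (2 * inner \<zeta> m / inner m m) * m"
  have TS: "tangent_space \<Gamma> circle z = {v. inner v m = 0}"
    unfolding m_def by (rule tangent_space_circle) fact+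
  have im: "inner (\<i> * m) m = 0" by (simp add: inner_complex_def)
  have "(THE \<zeta>'. (\<forall>v\<in>{v. inner v m = 0}. inner \<zeta>' v = inner \<zeta> v) \<and>
     (\<forall>n. (\<forall>v\<in>{v. inner v m = 0}. inner n v = 0) \<longrightarrow> inner \<zeta>' n = - inner \<zeta> n)) = ?\<zeta>"
  proof (rule the_equality)
    have inn: "inner ?\<zeta> v = inner \<zeta> v - 2 * inner \<zeta> m / inner m m * inner v m" for v
      unfolding scaleR_conv_of_real[symmetric] inner_diff_left inner_scaleR_left
      by (simp add: inner_commute)
    show "(\<forall>v\<in>{v. inner v m = 0}. inner ?\<zeta> v = inner \<zeta> v) \<and>
     (\<forall>n. (\<forall>v\<in>{v. inner v m = 0}. inner n v = 0) \<longrightarrow> inner ?\<zeta> n = - inner \<zeta> n)"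
    proof (intro conjI ballI allI impI)
      fix n assume n: "\<forall>v\<in>{v. inner v m = 0}. inner n v = 0"
      then have "inner n (\<i> * m) = 0" using im by simp
      \<comment> \<open>A vector orthogonal to the whole tangent line is a multiple of
        \<open>m\<close>.\<close>
      then have e: "of_real (inner n m) * m = of_real (inner m m) * n" using inner_decomposition[of n m] by simp
      have "inner n m *\<^sub>R m = inner m m *\<^sub>R n" using e by (simp add: scaleR_conv_of_real)
      then have "inner \<zeta> (inner n m *\<^sub>R m) = inner \<zeta> (inner m m *\<^sub>R n)" by simp
      then show "inner ?\<zeta> n = - inner \<zeta> n" unfolding inn using m0 by (simp add: field_simps)
    next
      fix v assume "v \<in> {v. inner v m = 0}"
      then show "inner ?\<zeta> v = inner \<zeta> v" unfolding inn by simp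
    qed
  next
    fix \<zeta>' assume *: "(\<forall>v\<in>{v. inner v m = 0}. inner \<zeta>' v = inner \<zeta> v) \<and>
     (\<forall>n. (\<forall>v\<in>{v. inner v m = 0}. inner n v = 0) \<longrightarrow> inner \<zeta>' n = - inner \<zeta> n)"
    then have "inner \<zeta>' (\<i> * m) = inner \<zeta> (\<i> * m)" "inner \<zeta>' m = - inner \<zeta> m"
      using im by (auto simp: inner_commute)
    then have "of_real (inner m m) * (\<zeta>' - \<zeta>) = of_real (- 2 * inner \<zeta> m) * m"
      using inner_decomposition[of \<zeta>' m] inner_decomposition[of \<zeta> m] by (simp add: algebra_simps)
    then show "\<zeta>' = ?\<zeta>" using m0 by (simp add: field_simps)
  qed
  then show ?thesis by (simp add: hreflect_def TS)
qed

text \<open>The usual reflection formula; the normal vector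
  \<open>hvec z1 - cosh r *\<^sub>R pos x\<close> has square \<open>- (sinh r)\<^sup>2\<close>,
  hence the plus sign.\<close>

lemma hreflect:
  assumes z1: "z1 \<in> proj \<Gamma> w" and x: "fst x \<in> hplane" and d: "hdist z1 (fst x) = r"
  shows fst_hreflect: "fst (hreflect \<Gamma> circle x) = fst x"
    and vel_hreflect: "vel (hreflect \<Gamma> circle x) =
      vel x + (2 * mink (vel x) (hvec z1 - cosh r *\<^sub>R pos x) / (sinh r)\<^sup>2) *\<^sub>R (hvec z1 - cosh r *\<^sub>R pos x)"
proof -
  obtain z \<zeta> where z: "x = (z, \<zeta>)" by (cases x)
  define m where "m = z - ecenter z1 r"
  define N where "N = hvec z1 - cosh r *\<^sub>R hvec z"
  have zh: "z \<in> hplane" and dz: "hdist z1 z = r" using x d by (auto simp: z)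
  have z1h: "z1 \<in> hplane" using z1 w by (rule proj_in_hplane)
  have y: "Im z > 0" "Im z1 > 0" using zh z1h by (auto simp: hplane_def)
  note hr = hreflect_circle[OF z1 zh dz, of \<zeta>, folded m_def]
  show "fst (hreflect \<Gamma> circle x) = fst x" by (simp add: z hr)
  have mm: "inner m m = (Im z1 * sinh r)\<^sup>2"
    using hdist_eq_iff_euclidean[OF z1h zh, of r] r dz by (simp add: m_def)
  have tm: "tvec z m = - (Im z * Im z1) *\<^sub>R N"
    unfolding m_def N_def using dz r hdist_eq_iff[OF z1h zh, of r] by (intro tvec_radial z1h zh) simp
  have "- (Im z)\<^sup>2 * inner \<zeta> m = - (Im z * Im z1) * mink (tvec z \<zeta>) N"
    unfolding mink_tvec[symmetric] tm mink_linear ..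
  then have "Im z * inner \<zeta> m = Im z1 * mink (tvec z \<zeta>) N" using y by (simp add: power2_eq_square)
  then have "inner \<zeta> m = Im z1 * mink (tvec z \<zeta>) N / Im z" using y by (simp add: field_simps)
  then have k: "2 * inner \<zeta> m / inner m m * (Im z * Im z1) = 2 * mink (tvec z \<zeta>) N / (sinh r)\<^sup>2"
    unfolding mm using y r by (simp add: field_simps power2_eq_square)
  have "vel (hreflect \<Gamma> circle x) = tvec z \<zeta> - (2 * inner \<zeta> m / inner m m) *\<^sub>R tvec z m"
    unfolding z hr fst_conv snd_conv tvec_linear ..
  also have "\<dots> = tvec z \<zeta> + (2 * inner \<zeta> m / inner m m * (Im z * Im z1)) *\<^sub>R N" by (simp add: tm)
  finally show "vel (hreflect \<Gamma> circle x) =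
      vel x + (2 * mink (vel x) (hvec z1 - cosh r *\<^sub>R pos x) / (sinh r)\<^sup>2) *\<^sub>R (hvec z1 - cosh r *\<^sub>R pos x)"
    unfolding k by (simp add: z N_def)
qed

section \<open>Times at which a geodesic meets a lift of the circle\<close>

lemma hdist_geo_less:
  assumes x: "x \<in> unit_covectors" and z: "z \<in> hplane" "hdist z (geo x t) = r" and h: "\<bar>s - t\<bar> < R - r"
  shows "hdist z (geo x s) < R"
proof -
  define y where "y = hflow t x"
  define h where "h = s - t"
  have y: "y \<in> unit_covectors" "fst y = geo x t" using x by (simp_all add: y_def hflow_unit fst_hflow)
  have g: "geo x s = geo y h" using x by (simp add: y_def geo_hflow h_def)
  have p: "mink (hvec z) (pos y) = cosh r"
    using z(2) r y hdist_eq_iff[OF z(1) geo_in_hplane[OF x, of t], of r] by simp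
  \<comment> \<open>With the velocity bound, the addition theorem for \<open>cosh\<close> yields the
    triangle inequality.\<close>
  have "sinh h * mink (hvec z) (vel y) \<le> \<bar>sinh h * mink (hvec z) (vel y)\<bar>" by simp
  also have "\<dots> \<le> sinh \<bar>h\<bar> * sinh r"
    unfolding abs_mult using mink_vel_bound[OF y(1) z(1) p] r by (intro mult_mono) auto
  finally have "mink (hvec z) (hvec (geo y h)) \<le> cosh \<bar>h\<bar> * cosh r + sinh \<bar>h\<bar> * sinh r"
    unfolding hvec_geo[OF y(1)] mink_linear p by simp
  also have "\<dots> = cosh (\<bar>h\<bar> + r)" by (simp add: cosh_add)
  also have "\<dots> < cosh R" using r h by (subst cosh_real_nonneg_less_iff) (simp_all add: h_def)
  finally show ?thesis using hdist_less_iff[OF z(1) geo_in_hplane[OF x, of s], of R] R by (simp add: g)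
qed

text \<open>All lifts met close to time \<open>T\<close> have centres closer than \<open>R\<close>
  to \<open>geo x T\<close>, so there is only one; for a fixed centre, meeting is a closed
  condition.\<close>

lemma circle_times_closed:
  assumes x: "x \<in> unit_covectors"
    and T: "\<And>\<epsilon>. 0 < \<epsilon> \<Longrightarrow> \<exists>t. (\<exists>z\<in>proj \<Gamma> w. hdist z (geo x t) = r) \<and> \<bar>t - T\<bar> < \<epsilon>"
  shows "\<exists>z\<in>proj \<Gamma> w. hdist z (geo x T) = r"
proof -
  have less: "hdist z (geo x T) < R" if "z \<in> proj \<Gamma> w" "hdist z (geo x t) = r" "\<bar>t - T\<bar> < R - r" for z t
    using hdist_geo_less[OF x proj_in_hplane[OF that(1) w] that(2), of T] that(3) by simp
  obtain t0 z0 where z0: "z0 \<in> proj \<Gamma> w" "hdist z0 (geo x t0) = r" "\<bar>t0 - T\<bar> < R - r"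
    using T[of "R - r"] r by auto
  have z0h: "z0 \<in> hplane" using z0(1) w by (rule proj_in_hplane)
  define f where "f t = mink (hvec z0) (hvec (geo x t))" for t
  have f: "hdist z0 (geo x t) = r \<longleftrightarrow> f t = cosh r" for t
    unfolding f_def by (rule hdist_eq_iff[OF z0h geo_in_hplane[OF x]]) (use r in simp)
  have "f T = cosh r"
  proof (rule ccontr)
    assume ne: "f T \<noteq> cosh r"
    have "f = (\<lambda>t. cosh t * mink (hvec z0) (pos x) + sinh t * mink (hvec z0) (vel x))"
      by (rule ext) (simp only: f_def hvec_geo[OF x] mink_linear)
    then have "isCont f T" by (simp add: isCont_def) (intro tendsto_intros)
    then have "\<forall>\<^sub>F t in nhds T. f t \<noteq> cosh r"
      using ne by (intro tendsto_imp_eventually_ne) (simp_all add: isCont_def tendsto_at_iff_tendsto_nhds)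
    then obtain \<delta> where \<delta>: "\<delta> > 0" "\<And>t. dist t T < \<delta> \<Longrightarrow> f t \<noteq> cosh r"
      unfolding eventually_nhds_metric by blast
    obtain t z where t: "z \<in> proj \<Gamma> w" "hdist z (geo x t) = r" "\<bar>t - T\<bar> < min \<delta> (R - r)"
      using T[of "min \<delta> (R - r)"] \<delta> r by auto
    then have "z = z0"
      by (intro orbit_separated[OF t(1) z0(1) geo_in_hplane[OF x, of T]] less[OF t(1,2)] less[OF z0]) simp
    then show False using t f \<delta>(2)[of t] by (simp add: dist_real_def)
  qed
  then have "hdist z0 (geo x T) = r" by (simp add: f)
  with z0(1) show ?thesis by (rule bexI[rotated])
qed

text \<open>For small times only the circle around \<open>w\<close> can be met, and it is met at
  most once more: without the root \<open>t = 0\<close> the equation is linear in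
  \<open>tanh (t / 2)\<close>. This is what excludes \<open>T = 0\<close>.\<close>

lemma circle_times_isolated:
  assumes x: "x \<in> unit_covectors" and d: "hdist w (fst x) = r"
  obtains \<delta> where "\<delta> > 0" "\<And>t z. t \<noteq> 0 \<Longrightarrow> z \<in> proj \<Gamma> w \<Longrightarrow> hdist z (geo x t) = r \<Longrightarrow> \<delta> \<le> \<bar>t\<bar>"
proof -
  define u where "u = mink (hvec w) (vel x)"
  have xh: "fst x \<in> hplane" using x by (simp add: unit_covectors_iff)
  have p: "mink (hvec w) (pos x) = cosh r" using d r by (subst hdist_eq_iff[symmetric]) (simp_all add: w xh)
  have on: "cosh t * cosh r + sinh t * u = cosh r" if "z \<in> proj \<Gamma> w" "hdist z (geo x t) = r" "\<bar>t\<bar> < R - r" for z t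
  proof -
    have "hdist z (geo x 0) < R"
      by (rule hdist_geo_less[OF x proj_in_hplane[OF that(1) w] that(2)]) (use that in simp)
    then have "z = w"
      using orbit_separated[OF that(1) proj_self xh] d r x by (simp add: geo_0)
    then show ?thesis
      using that(2) hdist_eq_iff[OF w geo_in_hplane[OF x], of r t] r x
      by (simp add: hvec_geo mink_linear p u_def)
  qed
  have uniq: "s = t" if "s \<noteq> 0" "t \<noteq> 0" "cosh s * cosh r + sinh s * u = cosh r"
    "cosh t * cosh r + sinh t * u = cosh r" for s t
  proof -
    have *: "cosh r * (cosh s - 1) = - (sinh s * u)"
      if "cosh s * cosh r + sinh s * u = cosh r" for s
      using that by (simp add: right_diff_distrib mult.commute)
    have "sinh t * (cosh r * (cosh s - 1)) = sinh s * (cosh r * (cosh t - 1))"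
      unfolding *[OF that(3)] *[OF that(4)] by (simp add: mult.left_commute)
    then have "cosh r * (sinh t * (cosh s - 1)) = cosh r * (sinh s * (cosh t - 1))"
      by (simp only: mult.left_commute)
    then have e: "sinh t * (cosh s - 1) = sinh s * (cosh t - 1)"
      by (simp only: mult_left_cancel[OF cosh_real_nonzero])
    \<comment> \<open>After passing to half arguments, \<open>sinh (s / 2)\<close> and
      \<open>sinh (t / 2)\<close> cancel and equality of the two values of \<open>tanh\<close>
      remains.\<close>
    have half: "sinh v = 2 * sinh (v / 2) * cosh (v / 2)" "cosh v - 1 = 2 * (sinh (v / 2))\<^sup>2" for v :: real
      using sinh_double[of "v / 2"] cosh_double_cosh[of "v / 2"] cosh_square_eq[of "v / 2"] by simp_all
    have "sinh (s / 2) * sinh (t / 2) * (cosh (t / 2) * sinh (s / 2) - cosh (s / 2) * sinh (t / 2)) = 0"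
      using e unfolding half[of s] half[of t] by algebra
    moreover have "sinh (s / 2) * sinh (t / 2) \<noteq> 0" using that(1,2) by simp
    ultimately have "cosh (t / 2) * sinh (s / 2) - cosh (s / 2) * sinh (t / 2) = 0"
      by (metis mult_eq_0_iff)
    then have "sinh (s / 2 - t / 2) = 0" by (simp add: sinh_diff mult.commute)
    then show "s = t" by simp
  qed
  show ?thesis
  proof (cases "\<exists>t1. t1 \<noteq> 0 \<and> cosh t1 * cosh r + sinh t1 * u = cosh r")
    case True
    then obtain t1 where t1: "t1 \<noteq> 0" "cosh t1 * cosh r + sinh t1 * u = cosh r" by blast
    show ?thesis
    proof (rule that[of "min (R - r) \<bar>t1\<bar>"])
      fix t z assume t: "t \<noteq> 0" "z \<in> proj \<Gamma> w" "hdist z (geo x t) = r"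
      have "t = t1" if "\<bar>t\<bar> < R - r" using uniq[OF t(1) t1(1) on[OF t(2,3) that] t1(2)] .
      then show "min (R - r) \<bar>t1\<bar> \<le> \<bar>t\<bar>" by (cases "\<bar>t\<bar> < R - r") simp_all
    qed (use r t1 in simp)
  next
    case False
    show ?thesis
    proof (rule that[of "R - r"])
      fix t z assume t: "t \<noteq> 0" "z \<in> proj \<Gamma> w" "hdist z (geo x t) = r"
      show "R - r \<le> \<bar>t\<bar>"
      proof (rule ccontr)
        assume "\<not> R - r \<le> \<bar>t\<bar>"
        then have "cosh t * cosh r + sinh t * u = cosh r" by (intro on[OF t(2,3)]) simp
        with False t(1) show False by blast
      qed
    qed (use r in simp)
  qed
qed

lemma gflow_in_circleD:
  assumes x: "x \<in> unit_covectors" and g: "gflow t (cov_proj \<Gamma> x) \<in> cosphere_over \<Gamma> circle"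
  shows "\<exists>z\<in>proj \<Gamma> w. hdist z (geo x t) = r"
proof -
  have "footpoint (gflow t (cov_proj \<Gamma> x)) = proj \<Gamma> (geo x t)"
    unfolding footpoint_def gflow_def cov_proj_def proj_def image_image
    using x by (intro image_cong refl) (simp add: moebius_hflow fst_hflow G_det)
  then show ?thesis using g proj_in_circle_iff[OF geo_in_hplane[OF x]] by (auto simp: cosphere_over_def)
qed

section \<open>The equations of a symmetric return\<close>

definition radial :: "vec3 \<Rightarrow> vec3" where
  "radial P = hvec w - cosh r *\<^sub>R P"

text \<open>For a symmetric return at time \<open>T\<close>, \<open>gap\<close> is \<open>(2 * cosh r * sinh T)\<^sup>2\<close> and \<open>vel_sum\<close> is
  \<open>- 2 * cosh r * sinh T\<close>.\<close>

definition gap :: "complex \<Rightarrow> complex \<Rightarrow> vec3 \<Rightarrow> real" where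
  "gap z1 z2 P = (mink P (hvec z1) + mink P (hvec z2))\<^sup>2 - 4 * (cosh r)\<^sup>2"

definition vel_sum :: "complex \<Rightarrow> complex \<Rightarrow> vec3 \<Rightarrow> vec3 \<Rightarrow> real" where
  "vel_sum z1 z2 P V = mink V (hvec z1) + mink V (hvec z2) +
     2 * mink V (radial P) * mink (radial P) (hvec z2) / (sinh r)\<^sup>2"

lemma reflection_symmetric_imp:
  assumes x: "x \<in> unit_covectors" and d: "hdist w (fst x) = r"
    and j: "j \<noteq> 0" and X: "cov_proj \<Gamma> x \<in> reflection_symmetric \<Gamma> circle j"
  shows "\<exists>z1\<in>proj \<Gamma> w. \<exists>z2\<in>proj \<Gamma> w.
    0 < gap z1 z2 (pos x) \<and> (vel_sum z1 z2 (pos x) (vel x))\<^sup>2 = gap z1 z2 (pos x)"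
proof -
  define T where "T = real_of_ereal (return_time \<Gamma> circle j (cov_proj \<Gamma> x))"
  have T: "return_time \<Gamma> circle j (cov_proj \<Gamma> x) = ereal T"
    and sym: "reflect \<Gamma> circle (gflow T (cov_proj \<Gamma> x)) = gflow T (reflect \<Gamma> circle (cov_proj \<Gamma> x))"
    using X by (auto simp: reflection_symmetric_def T_def ereal_real Let_def)
  obtain \<delta> where \<delta>: "\<delta> > 0" "\<And>t z. t \<noteq> 0 \<Longrightarrow> z \<in> proj \<Gamma> w \<Longrightarrow> hdist z (geo x t) = r \<Longrightarrow> \<delta> \<le> \<bar>t\<bar>"
    by (rule circle_times_isolated[OF x d]) (rule that)
  have approx: "\<exists>t. t \<noteq> 0 \<and> (\<exists>z\<in>proj \<Gamma> w. hdist z (geo x t) = r) \<and> \<bar>t - T\<bar> < \<epsilon>" if "\<epsilon> > 0" for \<epsilon>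
    using return_time_approx[OF j T that] gflow_in_circleD[OF x] by blast
  \<comment> \<open>Otherwise there would be nonzero meeting times of absolute value below
    \<open>\<delta>\<close>.\<close>
  have T0: "T \<noteq> 0" using approx[OF \<delta>(1)] \<delta>(2) by force
  obtain z1 where z1: "z1 \<in> proj \<Gamma> w" "hdist z1 (geo x T) = r"
    using circle_times_closed[OF x, of T] approx by blast
  have z1h: "z1 \<in> hplane" using z1(1) w by (rule proj_in_hplane)
  define y where "y = hflow T x"
  have xh: "fst x \<in> hplane" using x by (simp add: unit_covectors_iff)
  have y: "y \<in> unit_covectors" "fst y = geo x T" "fst y \<in> hplane" "hdist z1 (fst y) = r"
    using x z1 by (simp_all add: y_def hflow_unit fst_hflow geo_in_hplane)
  have "x \<in> cov_proj \<Gamma> x" unfolding cov_proj_def using G_id by (metis image_eqI moebius_id(2))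
  then have "hreflect \<Gamma> circle y \<in> reflect \<Gamma> circle (gflow T (cov_proj \<Gamma> x))"
    by (simp add: reflect_def gflow_def y_def)
  \<comment> \<open>Equality of orbits, read at the representative \<open>y\<close>, supplies the
    element of the group.\<close>
  then obtain A where A: "A \<in> \<Union>\<Gamma>"
    and yA: "hreflect \<Gamma> circle y = hflow T (hreflect \<Gamma> circle (moebius_cov A x))"
    unfolding sym unfolding reflect_def gflow_def cov_proj_def by blast
  have detA: "det A = 1" using A by (rule G_det)
  obtain B where B: "B \<in> \<Union>\<Gamma>" "moebius A (moebius B z1) = z1" using G_inv[OF A] z1h by metis
  \<comment> \<open>With the centre pulled back by \<open>A\<close>, the condition on the reflected
    orbit can be stated at \<open>x\<close>.\<close>
  define z2 where "z2 = moebius B z1"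
  have z2: "z2 \<in> proj \<Gamma> w" "z2 \<in> hplane" "moebius A z2 = z1"
    using proj_moebius_mem[OF B(1) z1(1) w] B z1h by (simp_all add: z2_def G_det moebius_in_hplane)
  define x' where "x' = moebius_cov A x"
  have x': "x' \<in> unit_covectors" "fst x' \<in> hplane" "pos x' = act A (pos x)" "vel x' = act A (vel x)"
    using detA x xh moebius_cov_unit[OF detA x]
    by (simp_all add: x'_def pos_moebius_cov vel_moebius_cov unit_covectors_iff)
  have fx': "fst x' = moebius A (fst x)" by (simp add: x'_def moebius_cov_def split_beta)
  \<comment> \<open>The reflection at \<open>x'\<close> takes place in the lift around
    \<open>moebius A w\<close>, so it is the image under \<open>A\<close> of the reflection at
    \<open>x\<close>.\<close>
  have Aw: "moebius A w \<in> proj \<Gamma> w" using proj_moebius_mem[OF A proj_self w] .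
  have dx': "hdist (moebius A w) (fst x') = r" using d by (simp add: fx' hdist_moebius detA w xh)
  define V2 where "V2 = vel x + (2 * mink (vel x) (radial (pos x)) / (sinh r)\<^sup>2) *\<^sub>R radial (pos x)"
  define U1 where "U1 = hvec z1"
  define U2 where "U2 = hvec z2"
  have U: "U1 = act A U2" using z2 detA by (simp add: U1_def U2_def flip: hvec_moebius)
  have aw: "hvec (moebius A w) - cosh r *\<^sub>R act A (pos x) = act A (radial (pos x))"
    by (simp add: radial_def act_linear hvec_moebius detA w)
  define x'' where "x'' = hreflect \<Gamma> circle x'"
  have x'': "pos x'' = act A (pos x)" "vel x'' = act A V2"
    using fst_hreflect[OF Aw x'(2) dx'] vel_hreflect[OF Aw x'(2) dx'] x'(3,4) detA
    by (simp_all add: x''_def aw V2_def mink_act act_linear)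
  have mxx: "mink (vel x) (vel x) = -1" using x by (simp add: unit_covectors_iff)
  have x''u: "x'' \<in> unit_covectors"
  proof -
    have w1: "mink (hvec w) (pos x) = cosh r" using d r by (subst hdist_eq_iff[symmetric]) (simp_all add: w xh)
    have nn: "mink (radial (pos x)) (radial (pos x)) = - (sinh r)\<^sup>2"
      using cosh_square_eq[of r] xh w w1
      by (simp add: radial_def mink_linear mink_commute[of "pos x" "hvec w"] power2_eq_square algebra_simps)
    have "mink V2 V2 = -1"
      using r by (simp add: V2_def mink_linear mxx nn mink_commute[of "radial (pos x)" "vel x"] power2_eq_square field_simps)
    then show ?thesis
      unfolding unit_covectors_iff x''(2) mink_act[OF detA] using fst_hreflect[OF Aw x'(2) dx'] x'(2)
      by (simp add: x''_def)
  qed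
  define p u p' u' where "p = mink (pos x) U1" and "u = mink (vel x) U1"
    and "p' = mink (pos x) U2" and "u' = mink V2 U2"
  have yr: "hreflect \<Gamma> circle y = hflow T x''" using yA by (simp add: x''_def x'_def)
  have yU: "mink (pos y) U1 = cosh r"
    using y(4) r hdist_eq_iff[OF z1h y(3), of r] by (simp add: U1_def mink_commute)
  have 1: "cosh T * p + sinh T * u = cosh r"
    using yU by (simp add: y_def pos_hflow x mink_linear p_def u_def)
  \<comment> \<open>Reflection keeps the footpoint, so the reflected orbit is on the circle around
    \<open>z1\<close> at time \<open>T\<close> as well.\<close>
  have "pos (hflow T x'') = pos y" using fst_hreflect[OF z1(1) y(3,4)] yr by simp
  then have "mink (pos (hflow T x'')) U1 = cosh r" using yU by simp
  then have 2: "cosh T * p' + sinh T * u' = cosh r"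
    by (simp only: pos_hflow[OF x''u] x'' mink_linear U mink_act[OF detA] p'_def u'_def)
  have "mink (vel (hreflect \<Gamma> circle y)) U1 = - mink (vel y) U1"
  proof -
    \<comment> \<open>The normal pairs with the centre to its own square, so reflection reverses the
      pairing of the velocity with the centre.\<close>
    have n: "mink (U1 - cosh r *\<^sub>R pos y) U1 = - (sinh r)\<^sup>2"
      using cosh_square_eq[of r] z1h yU by (simp add: mink_linear U1_def power2_eq_square)
    show ?thesis
      unfolding vel_hreflect[OF z1(1) y(3,4), folded U1_def] mink_linear(1,5) n
      using r by (simp add: mink_linear field_simps)
  qed
  then have 3: "sinh T * p' + cosh T * u' = - (sinh T * p + cosh T * u)"
    unfolding yr unfolding y_def vel_hflow[OF x''u] vel_hflow[OF x] x'' mink_linear p_def u_def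
    by (simp only: U mink_act[OF detA] p'_def u'_def)
  have ch: "(cosh T)\<^sup>2 = (sinh T)\<^sup>2 + 1" by (rule cosh_square_eq)
  have s: "p + p' = 2 * cosh r * cosh T" "u + u' = - 2 * cosh r * sinh T"
  proof -
    have a: "cosh T * (p + p') + sinh T * (u + u') = 2 * cosh r"
      using 1 2 by (simp add: distrib_left)
    have b: "sinh T * (p + p') + cosh T * (u + u') = 0"
      using 3 by (simp add: distrib_left)
    \<comment> \<open>The system for the two sums has the matrix of a hyperbolic rotation, whose
      determinant is 1.\<close>
    have "((cosh T)\<^sup>2 - (sinh T)\<^sup>2) * (p + p') =
        cosh T * (cosh T * (p + p') + sinh T * (u + u')) - sinh T * (sinh T * (p + p') + cosh T * (u + u'))"
      "((cosh T)\<^sup>2 - (sinh T)\<^sup>2) * (u + u') =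
        cosh T * (sinh T * (p + p') + cosh T * (u + u')) - sinh T * (cosh T * (p + p') + sinh T * (u + u'))"
      by algebra+
    then show "p + p' = 2 * cosh r * cosh T" "u + u' = - 2 * cosh r * sinh T"
      unfolding a b ch by simp_all
  qed
  have "gap z1 z2 (pos x) = 4 * (cosh r)\<^sup>2 * (sinh T)\<^sup>2"
    using s(1) ch by (simp add: gap_def p_def p'_def U1_def U2_def power_mult_distrib algebra_simps)
  moreover have "vel_sum z1 z2 (pos x) (vel x) = u + u'"
    by (simp add: vel_sum_def u_def u'_def V2_def U1_def U2_def mink_linear)
  then have "(vel_sum z1 z2 (pos x) (vel x))\<^sup>2 = 4 * (cosh r)\<^sup>2 * (sinh T)\<^sup>2"
    using s(2) by (simp add: power_mult_distrib)
  ultimately show ?thesis using T0 z1(1) z2(1) by (intro bexI[of _ z1] bexI[of _ z2]) simp_all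
qed

end

section \<open>The measure of the symmetric covectors\<close>

text \<open>The points \<open>(\<sigma>, \<nu>)\<close> lie on the unit circle and on one of two
  level lines of a linear form. Since \<open>K\<close> is positive, a vanishing form has no
  solutions at all.\<close>

lemma finite_section:
  fixes l1 l2 K :: real
  assumes "0 < K"
  shows "finite {\<sigma>. \<exists>\<nu>. \<nu>\<^sup>2 = 1 - \<sigma>\<^sup>2 \<and> (\<sigma> * l1 + \<nu> * l2)\<^sup>2 = K}"
proof -
  \<comment> \<open>Squaring \<open>\<nu> * l2 = k - \<sigma> * l1\<close> eliminates
    \<open>\<nu>\<close>. If \<open>l1 = l2 = 0\<close>, the constant term \<open>k\<^sup>2\<close>
    keeps the polynomial nonzero.\<close>
  define q where "q k = [:k\<^sup>2 - l2\<^sup>2, - 2 * k * l1, l1\<^sup>2 + l2\<^sup>2:]" for k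
  have "finite {\<sigma>. poly (q k) \<sigma> = 0}" if "k\<^sup>2 = K" for k
  proof (rule poly_roots_finite)
    show "q k \<noteq> 0" using that assms by (auto simp: q_def sum_power2_eq_zero_iff)
  qed
  then have "finite ({\<sigma>. poly (q (sqrt K)) \<sigma> = 0} \<union> {\<sigma>. poly (q (- sqrt K)) \<sigma> = 0})"
    using assms by simp
  then show ?thesis
  proof (rule finite_subset[rotated], intro subsetI)
    fix \<sigma> assume "\<sigma> \<in> {\<sigma>. \<exists>\<nu>. \<nu>\<^sup>2 = 1 - \<sigma>\<^sup>2 \<and> (\<sigma> * l1 + \<nu> * l2)\<^sup>2 = K}"
    then obtain \<nu> where \<nu>: "\<nu>\<^sup>2 = 1 - \<sigma>\<^sup>2" "(\<sigma> * l1 + \<nu> * l2)\<^sup>2 = K" by blast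
    define k where "k = \<sigma> * l1 + \<nu> * l2"
    have "poly (q k) \<sigma> = (k - \<sigma> * l1)\<^sup>2 - (1 - \<sigma>\<^sup>2) * l2\<^sup>2"
      by (simp add: q_def power2_eq_square algebra_simps)
    also have "\<dots> = 0" unfolding \<nu>(1)[symmetric] by (simp add: k_def power_mult_distrib)
    finally have "poly (q k) \<sigma> = 0" .
    moreover have "k = sqrt K \<or> k = - sqrt K"
      using \<nu>(2) assms by (simp add: k_def flip: power2_eq_iff)
    ultimately show "\<sigma> \<in> {\<sigma>. poly (q (sqrt K)) \<sigma> = 0} \<union> {\<sigma>. poly (q (- sqrt K)) \<sigma> = 0}" by blast
  qed
qed

lemma null_sections:
  fixes l1 l2 K :: "real \<Rightarrow> real"
  assumes c: "continuous_on UNIV l1" "continuous_on UNIV l2" "continuous_on UNIV K"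
  shows "{(\<theta>, \<sigma>). 0 < K \<theta> \<and> (\<exists>\<nu>. \<nu>\<^sup>2 = 1 - \<sigma>\<^sup>2 \<and> (\<sigma> * l1 \<theta> + \<nu> * l2 \<theta>)\<^sup>2 = K \<theta>)} \<in> null_sets lborel"
    (is "?N \<in> _")
proof -
  \<comment> \<open>Two explicit square roots replace the quantifier, so that measurability can be
    read off.\<close>
  have sq: "(\<exists>\<nu>. \<nu>\<^sup>2 = 1 - \<sigma>\<^sup>2 \<and> P \<nu>) \<longleftrightarrow>
      \<sigma>\<^sup>2 \<le> 1 \<and> (P (sqrt (1 - \<sigma>\<^sup>2)) \<or> P (- sqrt (1 - \<sigma>\<^sup>2)))" for \<sigma> :: real and P
  proof
    assume "\<exists>\<nu>. \<nu>\<^sup>2 = 1 - \<sigma>\<^sup>2 \<and> P \<nu>"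
    then obtain \<nu> where \<nu>: "\<nu>\<^sup>2 = 1 - \<sigma>\<^sup>2" "P \<nu>" by blast
    have le: "\<sigma>\<^sup>2 \<le> 1" using \<nu>(1) zero_le_power2[of \<nu>] by linarith
    then have "\<nu>\<^sup>2 = (sqrt (1 - \<sigma>\<^sup>2))\<^sup>2" using \<nu>(1) by simp
    then have "\<nu> = sqrt (1 - \<sigma>\<^sup>2) \<or> \<nu> = - sqrt (1 - \<sigma>\<^sup>2)" by (simp only: power2_eq_iff)
    moreover note le
    ultimately show "\<sigma>\<^sup>2 \<le> 1 \<and> (P (sqrt (1 - \<sigma>\<^sup>2)) \<or> P (- sqrt (1 - \<sigma>\<^sup>2)))" using \<nu>(2) by blast
  next
    assume a: "\<sigma>\<^sup>2 \<le> 1 \<and> (P (sqrt (1 - \<sigma>\<^sup>2)) \<or> P (- sqrt (1 - \<sigma>\<^sup>2)))"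
    then have "(sqrt (1 - \<sigma>\<^sup>2))\<^sup>2 = 1 - \<sigma>\<^sup>2" "(- sqrt (1 - \<sigma>\<^sup>2))\<^sup>2 = 1 - \<sigma>\<^sup>2" by simp_all
    with a show "\<exists>\<nu>. \<nu>\<^sup>2 = 1 - \<sigma>\<^sup>2 \<and> P \<nu>" by blast
  qed
  have [measurable]: "l1 \<in> borel_measurable borel" "l2 \<in> borel_measurable borel" "K \<in> borel_measurable borel"
    using c by (auto intro: borel_measurable_continuous_onI)
  have "{x \<in> space (borel \<Otimes>\<^sub>M borel). 0 < K (fst x) \<and> (snd x)\<^sup>2 \<le> 1 \<and>
      ((snd x * l1 (fst x) + sqrt (1 - (snd x)\<^sup>2) * l2 (fst x))\<^sup>2 = K (fst x) \<or>
       (snd x * l1 (fst x) + - sqrt (1 - (snd x)\<^sup>2) * l2 (fst x))\<^sup>2 = K (fst x))}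
      \<in> sets (borel \<Otimes>\<^sub>M borel)" (is "?M \<in> _")
    by measurable
  also have "?M = ?N" unfolding sq by (auto simp: space_pair_measure)
  finally have N: "?N \<in> sets (lborel \<Otimes>\<^sub>M lborel)"
    by (simp only: sets_pair_measure_cong[OF sets_lborel sets_lborel])
  have "emeasure lborel (Pair \<theta> -` ?N) = 0" for \<theta>
  proof (cases "0 < K \<theta>")
    case True
    then have "finite (Pair \<theta> -` ?N)" using finite_section[OF True, of "l1 \<theta>" "l2 \<theta>"] by (simp add: vimage_def)
    then show ?thesis by (rule emeasure_lborel_countable[OF countable_finite])
  qed (simp add: vimage_def)
  then have "emeasure (lborel \<Otimes>\<^sub>M lborel) ?N = 0"
    by (simp add: lborel.emeasure_pair_measure_alt[OF N])
  with N show ?thesis unfolding lborel_prod by (simp only: null_sets_def mem_Collect_eq)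
qed

lemma outer_measure_of_eq_0: "A \<subseteq> N \<Longrightarrow> N \<in> null_sets M \<Longrightarrow> outer_measure_of M A = 0"
proof -
  assume "A \<subseteq> N" "N \<in> null_sets M"
  then have "outer_measure_of M A \<le> emeasure M N"
    unfolding outer_measure_of_def by (intro INF_lower) auto
  then show ?thesis using \<open>N \<in> null_sets M\<close> by auto
qed

lemma continuous_on_mink:
  "continuous_on S f \<Longrightarrow> continuous_on S g \<Longrightarrow> continuous_on S (\<lambda>x. mink (f x) (g x))"
  unfolding mink_def by (intro continuous_intros) simp_all

lemma bounded_linear_tvec: "bounded_linear (tvec z)"
proof (intro linear_conv_bounded_linear[THEN iffD1] linearI)
  show "tvec z (a *\<^sub>R \<zeta>) = a *\<^sub>R tvec z \<zeta>" for a \<zeta>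
    by (simp add: scaleR_conv_of_real tvec_linear)
qed (simp add: tvec_linear)

context embedded_circle
begin

section \<open>A moving frame along the circle\<close>

definition ray :: "real \<Rightarrow> vec3" where
  "ray \<theta> = tvec w (cis \<theta> / of_real (Im w))"

text \<open>The derivative of \<open>ray\<close>. Being orthogonal to \<open>hvec w\<close> and
  \<open>ray \<theta>\<close>, it is also the unit tangent of the circle at
  \<open>cpos \<theta>\<close>.\<close>

definition ray' :: "real \<Rightarrow> vec3" where
  "ray' \<theta> = tvec w (\<i> * cis \<theta> / of_real (Im w))"

definition cpos :: "real \<Rightarrow> vec3" where
  "cpos \<theta> = cosh r *\<^sub>R hvec w + sinh r *\<^sub>R ray \<theta>"

text \<open>The derivative of \<open>cpos \<theta>\<close> with respect to the radius, that is, the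
  outward unit normal.\<close>

definition cnormal :: "real \<Rightarrow> vec3" where
  "cnormal \<theta> = sinh r *\<^sub>R hvec w + cosh r *\<^sub>R ray \<theta>"

lemma Im_w: "0 < Im w"
  using w by (simp add: hplane_def)

lemma mink_ray:
  "mink (ray \<theta>) (ray \<theta>) = -1" "mink (ray' \<theta>) (ray' \<theta>) = -1" "mink (ray \<theta>) (ray' \<theta>) = 0"
  "mink (hvec w) (ray \<theta>) = 0" "mink (hvec w) (ray' \<theta>) = 0"
  "mink (ray \<theta>) (hvec w) = 0" "mink (ray' \<theta>) (hvec w) = 0" "mink (ray' \<theta>) (ray \<theta>) = 0"
  using Im_w
  by (simp_all add: ray_def ray'_def mink_tvec)
     (simp_all add: inner_complex_def power2_eq_square field_simps flip: add_divide_distrib)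

lemma cpos:
  shows hvec_polar_circle: "hvec (polar_circle w r \<theta>) = cpos \<theta>"
    and polar_circle_in_hplane: "polar_circle w r \<theta> \<in> hplane"
    and polar_circle_eq: "polar_circle w r \<theta> = pt (cpos \<theta>)"
    and hdist_polar_circle: "hdist w (polar_circle w r \<theta>) = r"
proof -
  define x where "x = (w, cis \<theta> / of_real (Im w))"
  have x: "x \<in> unit_covectors"
    using w mink_ray(1)[of \<theta>] by (simp add: x_def unit_covectors_iff ray_def)
  have p: "polar_circle w r \<theta> = geo x r" by (simp add: polar_circle_def fst_hflow[OF x] flip: x_def)
  show c: "hvec (polar_circle w r \<theta>) = cpos \<theta>"
    by (simp add: p hvec_geo[OF x] cpos_def ray_def) (simp add: x_def)
  show h: "polar_circle w r \<theta> \<in> hplane" by (simp add: p geo_in_hplane[OF x])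
  show "polar_circle w r \<theta> = pt (cpos \<theta>)" using h by (simp flip: c)
  show "hdist w (polar_circle w r \<theta>) = r"
    using r w by (subst hdist_eq_iff) (simp_all add: h c cpos_def mink_linear mink_ray)
qed

lemma cpos_has_vector_derivative: "(cpos has_vector_derivative sinh r *\<^sub>R ray' \<theta>) (at \<theta>)"
proof -
  have "((\<lambda>\<theta>. cis \<theta> / of_real (Im w)) has_vector_derivative \<i> * cis \<theta> / of_real (Im w)) (at \<theta>)"
    unfolding has_vector_derivative_complex_iff
    by (auto intro!: derivative_eq_intros simp: Im_w less_imp_neq[symmetric])
  from bounded_linear.has_vector_derivative[OF bounded_linear_tvec this]
  have "(ray has_vector_derivative ray' \<theta>) (at \<theta>)" by (simp add: ray_def[abs_def] ray'_def)
  then show ?thesis unfolding cpos_def[abs_def]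
    by (auto intro!: derivative_eq_intros)
qed

text \<open>Identifies the half plane tangent with \<open>ray'\<close>. The constant speed makes the
  symplectic measure a multiple of Lebesgue measure.\<close>

lemma circle_frame:
  obtains \<tau> where "tvec (polar_circle w r \<theta>) \<tau> = ray' \<theta>"
    "circle_speed w r \<theta> = sinh r" "circle_tangent w r \<theta> = sharp (polar_circle w r \<theta>) \<tau>"
proof -
  define z where "z = polar_circle w r \<theta>"
  have z: "z \<in> hplane" "hvec z = cpos \<theta>" by (simp_all add: z_def hvec_polar_circle polar_circle_in_hplane)
  have y: "Im z > 0" using z by (simp add: hplane_def)
  have "mink (hvec z) (ray' \<theta>) = 0" by (simp add: z cpos_def mink_linear mink_ray)
  then obtain \<tau> where \<tau>: "ray' \<theta> = tvec z \<tau>" using tvec_surj[OF z(1)] by metis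
  have s: "sinh r > 0" using r by simp
  have "((\<lambda>\<theta>. pt (cpos \<theta>)) has_vector_derivative sharp z (of_real (sinh r) * \<tau>)) (at \<theta>)"
    by (rule pt_has_vector_derivative[OF cpos_has_vector_derivative])
       (simp_all add: z tvec_linear \<tau>)
  then have d: "vector_derivative (polar_circle w r) (at \<theta>) = sharp z (of_real (sinh r) * \<tau>)"
    by (simp add: polar_circle_eq[symmetric] vector_derivative_at)
  have "(Im z * cmod \<tau>)\<^sup>2 = 1"
    using mink_ray(2)[of \<theta>] by (simp add: \<tau> mink_tvec power_mult_distrib power2_norm_eq_inner)
  moreover have "0 \<le> Im z * cmod \<tau>" using y by simp
  ultimately have "Im z * cmod \<tau> = 1" unfolding power2_eq_1_iff by arith
  then have sp: "circle_speed w r \<theta> = sinh r"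
    unfolding circle_speed_def d z_def[symmetric] using y s
    by (simp add: hnorm_def sharp_def norm_mult power2_eq_square mult_ac)
  show ?thesis
  proof (rule that)
    show "tvec (polar_circle w r \<theta>) \<tau> = ray' \<theta>" using \<tau> by (simp add: z_def)
    show "circle_tangent w r \<theta> = sharp (polar_circle w r \<theta>) \<tau>"
      unfolding circle_tangent_def sp d using s by (simp add: sharp_def z_def)
  qed (rule sp)
qed

text \<open>The coordinate \<open>\<sigma>\<close> of the tangential projection is the coefficient
  of the unit tangent. The sign of \<open>\<nu>\<close> stays open, which covers both halves of the
  cosphere bundle.\<close>

lemma velocity_decomposition:
  assumes x: "x \<in> unit_covectors" "fst x = polar_circle w r \<theta>"
  obtains \<nu> where "\<nu>\<^sup>2 = 1 - (inner (snd x) (circle_tangent w r \<theta>))\<^sup>2"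
    "vel x = inner (snd x) (circle_tangent w r \<theta>) *\<^sub>R ray' \<theta> + \<nu> *\<^sub>R cnormal \<theta>"
proof -
  define z where "z = polar_circle w r \<theta>"
  define \<zeta> where "\<zeta> = snd x"
  have z: "z \<in> hplane" "hvec z = cpos \<theta>" by (simp_all add: z_def hvec_polar_circle polar_circle_in_hplane)
  have y: "Im z > 0" using z by (simp add: hplane_def)
  obtain \<tau> where \<tau>: "tvec z \<tau> = ray' \<theta>" "circle_tangent w r \<theta> = sharp z \<tau>"
    unfolding z_def using circle_frame[of \<theta>] by metis
  define \<sigma> where "\<sigma> = inner \<zeta> (circle_tangent w r \<theta>)"
  have \<sigma>: "\<sigma> = (Im z)\<^sup>2 * inner \<zeta> \<tau>"
    by (simp add: \<sigma>_def \<tau>(2) sharp_def flip: scaleR_conv_of_real of_real_power)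
  have "(Im z)\<^sup>2 * inner \<tau> \<tau> = 1" using mink_ray(2)[of \<theta>] by (simp add: mink_tvec flip: \<tau>(1))
  then have n: "inner \<tau> \<tau> = 1 / (Im z)\<^sup>2" using y by (simp add: field_simps)
  define F where "F = tvec z (\<i> * \<tau>)"
  have expand: "tvec z \<eta> = ((Im z)\<^sup>2 * inner \<eta> \<tau>) *\<^sub>R ray' \<theta> + ((Im z)\<^sup>2 * inner \<eta> (\<i> * \<tau>)) *\<^sub>R F" for \<eta>
  proof -
    have "\<eta> = of_real ((Im z)\<^sup>2) * (of_real (inner \<tau> \<tau>) * \<eta>)" using y by (simp add: n)
    also have "\<dots> = of_real ((Im z)\<^sup>2 * inner \<eta> \<tau>) * \<tau> + of_real ((Im z)\<^sup>2 * inner \<eta> (\<i> * \<tau>)) * (\<i> * \<tau>)"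
      by (simp only: inner_decomposition[of \<eta> \<tau>, symmetric]) (simp add: algebra_simps)
    finally have "tvec z \<eta> = tvec z \<dots>" by (rule arg_cong)
    then show ?thesis by (simp only: tvec_linear \<tau>(1) F_def)
  qed
  have F: "mink F F = -1" "mink (ray' \<theta>) F = 0" "mink F (ray' \<theta>) = 0"
  proof -
    show "mink F F = -1"
      using n y by (simp add: F_def mink_tvec) (simp add: inner_complex_def field_simps)
    show "mink (ray' \<theta>) F = 0" "mink F (ray' \<theta>) = 0"
      by (simp_all add: F_def mink_tvec inner_complex_def flip: \<tau>(1))
  qed
  have "mink (hvec z) (cnormal \<theta>) = 0"
    using w by (simp add: z cpos_def cnormal_def mink_linear mink_ray)
  then obtain \<phi> where \<phi>: "cnormal \<theta> = tvec z \<phi>" using tvec_surj[OF z(1)] by metis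
  \<comment> \<open>\<open>k\<close> turns out to be 1 or -1, the orientation of \<open>F\<close>
    against the outward normal; it is absorbed into \<open>\<nu>\<close>.\<close>
  define k where "k = (Im z)\<^sup>2 * inner \<phi> (\<i> * \<tau>)"
  have "mink (cnormal \<theta>) (ray' \<theta>) = 0" by (simp add: cnormal_def mink_linear mink_ray)
  then have "(Im z)\<^sup>2 * inner \<phi> \<tau> = 0" by (simp add: \<phi> mink_tvec flip: \<tau>(1))
  then have kF: "cnormal \<theta> = k *\<^sub>R F" using expand[of \<phi>] by (simp add: \<phi> k_def)
  have "mink (cnormal \<theta>) (cnormal \<theta>) = -1"
    using w cosh_square_eq[of r] by (simp add: cnormal_def mink_linear mink_ray power2_eq_square)
  then have k: "k * k = 1" by (simp add: kF mink_linear F)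
  then have "F = k *\<^sub>R cnormal \<theta>" by (simp add: kF)
  define \<nu> where "\<nu> = (Im z)\<^sup>2 * inner \<zeta> (\<i> * \<tau>) * k"
  have v: "vel x = \<sigma> *\<^sub>R ray' \<theta> + \<nu> *\<^sub>R cnormal \<theta>"
    using expand[of \<zeta>] \<open>F = k *\<^sub>R cnormal \<theta>\<close> x(2) by (simp add: z_def \<zeta>_def \<sigma>[folded \<zeta>_def] \<nu>_def)
  have "mink (vel x) (vel x) = -1" using x by (simp add: unit_covectors_iff)
  then have "\<nu>\<^sup>2 = 1 - \<sigma>\<^sup>2"
    using \<open>mink (cnormal \<theta>) (cnormal \<theta>) = -1\<close> \<open>mink (cnormal \<theta>) (ray' \<theta>) = 0\<close>
    by (simp add: v mink_linear mink_ray mink_commute[of "ray' \<theta>" "cnormal \<theta>"] power2_eq_square)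
  with v show ?thesis by (intro that[of \<nu>]) (simp_all add: \<sigma>_def \<zeta>_def)
qed

lemma continuous_frame:
  "continuous_on UNIV cpos" "continuous_on UNIV ray'" "continuous_on UNIV cnormal"
proof -
  have t: "continuous_on UNIV (\<lambda>x. tvec w (f x))" if "continuous_on UNIV f" for f :: "real \<Rightarrow> complex"
    using bounded_linear.continuous_on[OF bounded_linear_tvec that] .
  have "continuous_on UNIV ray" "continuous_on UNIV ray'"
    unfolding ray_def[abs_def] ray'_def[abs_def] using Im_w by (auto intro!: t continuous_intros)
  then show "continuous_on UNIV cpos" "continuous_on UNIV ray'" "continuous_on UNIV cnormal"
    unfolding cpos_def[abs_def] cnormal_def[abs_def] by (auto intro!: continuous_intros)
qed

lemma vel_sum_linear: "vel_sum z1 z2 P (a *\<^sub>R X + b *\<^sub>R Y) = a * vel_sum z1 z2 P X + b * vel_sum z1 z2 P Y"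
  by (simp add: vel_sum_def mink_linear add_divide_distrib algebra_simps)

lemma no_positive_reflection_symmetry: "\<not> positive_reflection_symmetry \<Gamma> w r"
proof -
  define B where "B = (\<Union>j\<in>{j. j \<noteq> 0}. reflection_symmetric \<Gamma> circle j)"
  define N where "N z1 z2 = {(\<theta>, \<sigma>). 0 < gap z1 z2 (cpos \<theta>) \<and> (\<exists>\<nu>. \<nu>\<^sup>2 = 1 - \<sigma>\<^sup>2 \<and>
    (\<sigma> * vel_sum z1 z2 (cpos \<theta>) (ray' \<theta>) + \<nu> * vel_sum z1 z2 (cpos \<theta>) (cnormal \<theta>))\<^sup>2 = gap z1 z2 (cpos \<theta>))}" for z1 z2
  have "N z1 z2 \<in> null_sets lborel" for z1 z2
    unfolding N_def
    by (rule null_sections; unfold vel_sum_def gap_def radial_def;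
        intro continuous_intros continuous_on_mink continuous_frame) (use r in simp_all)
  then have N: "(\<Union>z1\<in>proj \<Gamma> w. \<Union>z2\<in>proj \<Gamma> w. N z1 z2) \<in> null_sets lborel" (is "?N \<in> _")
    by (intro null_sets_UN' countable_orbit)
  have m: "symplectic_measure w r = density lborel (\<lambda>_. ennreal (sinh r))"
  proof -
    have "circle_speed w r \<theta> = sinh r" for \<theta> using circle_frame[of \<theta>] by metis
    then show ?thesis by (simp add: symplectic_measure_def case_prod_unfold)
  qed
  have null: "?N \<in> null_sets (symplectic_measure w r)"
  proof -
    have "AE x in lborel. x \<in> ?N \<longrightarrow> ennreal (sinh r) = 0"
      using AE_not_in[OF N] by eventually_elim blast
    then show ?thesis unfolding m using N by (subst null_sets_density_iff) (auto simp: null_sets_def)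
  qed
  \<comment> \<open>One null set serves both signs \<open>\<epsilon>\<close>, because
    \<open>N\<close> quantifies over \<open>\<nu>\<close>.\<close>
  have sub: "tangential_projection \<Gamma> w r \<epsilon> B \<subseteq> ?N" for \<epsilon>
  proof
    fix a assume "a \<in> tangential_projection \<Gamma> w r \<epsilon> B"
    then obtain \<theta> \<zeta> where a: "a = (\<theta>, inner \<zeta> (circle_tangent w r \<theta>))"
      and u: "(polar_circle w r \<theta>, \<zeta>) \<in> unit_covectors"
      and b: "cov_proj \<Gamma> (polar_circle w r \<theta>, \<zeta>) \<in> B"
      unfolding tangential_projection_def by blast
    define x where "x = (polar_circle w r \<theta>, \<zeta>)"
    obtain j where j: "j \<noteq> 0" "cov_proj \<Gamma> x \<in> reflection_symmetric \<Gamma> circle j"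
      using b by (auto simp: B_def x_def)
    have px: "pos x = cpos \<theta>" by (simp add: x_def hvec_polar_circle)
    have xu: "x \<in> unit_covectors" "hdist w (fst x) = r" using u by (simp_all add: x_def hdist_polar_circle)
    obtain z1 z2 where z: "z1 \<in> proj \<Gamma> w" "z2 \<in> proj \<Gamma> w" "0 < gap z1 z2 (cpos \<theta>)"
      "(vel_sum z1 z2 (cpos \<theta>) (vel x))\<^sup>2 = gap z1 z2 (cpos \<theta>)"
      using reflection_symmetric_imp[OF xu j] unfolding px by blast
    define \<sigma> where "\<sigma> = inner \<zeta> (circle_tangent w r \<theta>)"
    obtain \<nu> where \<nu>: "\<nu>\<^sup>2 = 1 - \<sigma>\<^sup>2" "vel x = \<sigma> *\<^sub>R ray' \<theta> + \<nu> *\<^sub>R cnormal \<theta>"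
      using velocity_decomposition[OF xu(1), of \<theta>] unfolding \<sigma>_def x_def by auto
    have "a \<in> N z1 z2"
      using z(3,4) \<nu>(1) unfolding \<nu>(2) vel_sum_linear by (auto simp: N_def a simp flip: \<sigma>_def)
    with z(1,2) show "a \<in> ?N" by blast
  qed
  have "mu_LH \<Gamma> w r B = 0"
    unfolding mu_LH_def by (simp add: outer_measure_of_eq_0[OF sub null])
  then show ?thesis by (simp add: positive_reflection_symmetry_def B_def)
qed

end

theorem lemma35:
  fixes \<Gamma> :: "(real^2^2) set set" and w :: complex and r :: real
  assumes "fuchsian \<Gamma>" and "finite_area \<Gamma>"
    and "w \<in> hplane" and "0 < r" and "ereal r < inj_radius \<Gamma> w"
  shows "\<not> positive_reflection_symmetry \<Gamma> w r"
proof -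
  \<comment> \<open>A supremum above \<open>r\<close> is exceeded by no more than it is approached:
    some radius beyond \<open>r\<close> belongs to the set.\<close>
  obtain R where "r < R" "inj_on (proj \<Gamma>) {z \<in> hplane. hdist w z < R}"
    using assms(5) unfolding inj_radius_def less_Sup_iff by auto
  then interpret embedded_circle \<Gamma> w r R
    using assms by unfold_locales
  show ?thesis by (rule no_positive_reflection_symmetry)
qed

end
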